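(* Let $\mathcal Z$ be a real separable Hilbert space. For $i=1,2$ let $F_i:\mathcal Z\to\mathcal Z$ be monotone and $L_{F_i}$-Lipschitz continuous and let $g_i\in\Gamma_0(\mathcal Z)$, with $\mathrm{dom}(g_1)\cap\mathrm{dom}(g_2)\neq\emptyset$. Let $\mathcal S_2=\mathrm{zer}(F_2+\partial g_2)$ and assume $\mathcal S_2\ne\emptyset$. Let $\mathcal S_1$ be the solution set of the hierarchical problem (see context) and assume $\mathcal S_1=\mathrm{zer}(F_1+\partial g_1+N_{\mathcal S_2})\neq\emptyset$. Assume that $\mathrm{dom}(g_1)\cap\mathrm{dom}(g_2)$ is closed and that for all compact sets $\mathcal A,\mathcal B\subset\mathrm{dom}(g_1)\cap\mathrm{dom}(g_2)$ one has $\sup_{(x,y)\in\mathcal A\times\mathcal B}|g_1(x)-g_1(y)|<\infty$. Let $(t_k)_{k\ge1}\subset(0,\infty)$ and let $(\sigma_k)_{k\ge1}\subset(0,\infty)$ be decreasing ($\sigma_{k+1}\le\sigma_k$), with $$\lim_{k\to\infty}\sigma_k=0,\quad \lim_{K\to\infty}\sum_{k=1}^K t_k=\infty,\quad \lim_{K\to\infty}\sigma_K\sum_{k=1}^K t_k=\infty,\quad \lim_{K\to\infty}\frac{\sum_{k=1}^K t_k\sigma_k}{\sum_{k=1}^K t_k}=0 .$$ Assume additionally that at least one of the following holds: (1) for every $p\in\mathrm{Range}(N_{\mathcal S_2})$, $\ \sum_{k=1}^\infty t_k\big[\sup_{z\in\mathcal S_2}\varphi^{(F_2,g_2)}(z,\sigma_kp)-\mathtt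 s(\sigma_kp\,|\,\mathcal S_2)\big]<\infty$; (2) $\mathrm{dom}(g_1)\cap\mathrm{dom}(g_2)$ is compact. Let $z^1=z^{1/2}\in\mathcal Z$ and let $(z^k),(z^{k+1/2})$ be generated by the optimistic extragradient method (see context), where $16t_k^2L_k^2\le1$ for all $k\ge1$ with $L_k=L_{F_2}+\sigma_kL_{F_1}$. Put $T_K=\sum_{k=1}^K t_k$ and $\bar z^K=\frac1{T_K}\sum_{k=1}^K t_kz^{k+1/2}$. (i) Let $\mathcal U_2\subset\mathrm{dom}(g_1)\cap\mathrm{dom}(g_2)$ be nonempty and compact. Then there exists a constant $C_{\mathcal U_2}>0$ (independent of $K$) such that for all $K\ge1$ $$\Theta_{\rm Feas}(\bar z^K|\mathcal U_2)\le\frac{\sup_{z\in\mathcal U_2}\|z^1-z\|^2}{2T_K}+\frac{\sum_{k=1}^K t_k\sigma_k}{T_K}\,C_{\mathcal U_2}.$$ (ii) Let $\mathcal U_1\subset\mathrm{dom}(g_1)\cap\mathrm{dom}(g_2)$ be compact with $\mathcal U_1\cap\mathcal S_1\ne\emptyset$. Then there exist constants $B_{\mathcal U_1},C_{\mathcal U_1}>0$ (independent of $K$) such that for all $K\ge1$ $$-B_{\mathcal U_1}\,\mathrm{dist}(\bar z^K,\mathcal S_2)\le\Theta_{\rm Opt}(\bar z^K|\mathcal U_1\cap\mathcal S_2)\le\frac{C_{\mathcal U_1}}{T_K\sigma_K}.$$ (iii) If $\mathcal S_2$ is $(\alpha,\rho)$-weakly sharp (with $\alpha>0$, $\rho\ge1$)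 and $\mathcal U_2$ in (i) satisfies $\mathcal U_2\cap\mathcal S_2\neq\emptyset$, then for the same set $\mathcal U_1$ as in (ii), and with the constants $C_{\mathcal U_2}$ from (i) and $B_{\mathcal U_1}$ from (ii), for all $K\ge 1$ $$-B_{\mathcal U_1}\left[\frac{\sup_{z\in\mathcal U_2}\|z^1-z\|^2}{2T_K(\alpha/\rho)}+\frac{C_{\mathcal U_2}\sum_{k=1}^K t_k\sigma_k}{(\alpha/\rho)T_K}\right]^{1/\rho}\le\Theta_{\rm Opt}(\bar z^K|\mathcal U_1\cap\mathcal S_2).$$
   Context: $\Gamma_0(\mathcal Z)$ is the class of proper convex lower semicontinuous functions $\mathcal Z\to(-\infty,+\infty]$; $\mathrm{dom}(g)=\{z: g(z)<\infty\}$; $\mathrm{zer}(A)=\{z:0\in A(z)\}$; $N_{\mathcal C}(z)=\{p:\langle p,z'-z\rangle\le0\ \forall z'\in\mathcal C\}$ for $z\in\mathcal C$ is the normal cone and $\mathrm{Range}(N_{\mathcal C})=\bigcup_{z\in\mathcal C}N_{\mathcal C}(z)$; $\mathtt s(p|\mathcal C)=\sup_{z\in\mathcal C}\langle p,z\rangle$ is the support function; $\mathrm{dist}(\cdot,\mathcal C)$ is the distance to $\mathcal C$; $\mathrm{prox}_G(u)=\mathrm{argmin}_{z}\{G(z)+\tfrac12\|z-u\|^2\}$. Hierarchical problem: find $z^*\in\mathcal S_2$ such that $\langle F_1(z^* ),z-z^*\rangle+g_1(z)-g_1(z^* )\ge0$ for all $z\in\mathcal S_2$, where $\mathcal S_2=\mathrm{zer}(F_2+\partial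 g_2)$. $\mathcal S_1$ denotes its set of solutions. Bifunction: $H^{(F,g)}(z,y)=\langle F(y),z-y\rangle+g(z)-g(y)$. Function $\varphi$: $\varphi^{(F_2,g_2)}(z,u)=\sup_{y\in\mathrm{dom}(g_2)}\{H^{(F_2,g_2)}(z,y)+\langle y,u\rangle\}$. Gap functions: $\Theta_{\rm Feas}(z|\mathcal U)=\sup_{y\in\mathcal U}H^{(F_2,g_2)}(z,y)$ and $\Theta_{\rm Opt}(z|\mathcal U\cap\mathcal S_2)=\sup_{y\in\mathcal U\cap\mathcal S_2}H^{(F_1,g_1)}(z,y)$. Weak sharpness: $\mathcal S_2$ is $(\alpha,\rho)$-weakly sharp, $\alpha>0$, $\rho\ge1$, if $H^{(F_2,g_2)}(z,z^* )\ge\frac\alpha\rho\,\mathrm{dist}(z,\mathcal S_2)^\rho$ for all $z^*\in\mathcal S_2$ and all $z\in\mathrm{dom}(g_2)$. Optimistic extragradient method: with $V_k=F_2+\sigma_kF_1$ and $G_k=g_2+\sigma_kg_1$, starting from $z^1=z^{1/2}$, for $k\ge1$: $$z^{k+1/2}=\mathrm{prox}_{t_kG_k}\big(z^k-t_kV_k(z^{k-1/2})\big),\qquad z^{k+1}=\mathrm{prox}_{t_kG_k}\big(z^k-t_kV_k(z^{k+1/2})\big).$$ *)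

theory Defs
  imports "HOL-Analysis.Analysis"
begin

definition edom :: "('a \<Rightarrow> ereal) \<Rightarrow> 'a set" where
  "edom g = {z. g z < \<infinity>}"

text \<open>
  The class \<open>\<Gamma>\<^sub>0\<close> of proper, convex, lower semicontinuous functions. As the value \<open>-\<infinity>\<close> is
  excluded and \<open>0 * \<infinity> = 0\<close> in \<^typ>\<open>ereal\<close>, the convexity inequality is also correct at the
  endpoints and for infinite function values.
\<close>

definition Gamma0 :: "('a::real_normed_vector \<Rightarrow> ereal) set" where
  "Gamma0 = {g.
     (\<forall>z. g z \<noteq> -\<infinity>) \<and> edom g \<noteq> {} \<and>
     (\<forall>x y. \<forall>u\<ge>0. \<forall>v\<ge>0. u + v = 1 \<longrightarrow>
        g (u *\<^sub>R x + v *\<^sub>R y) \<le> ereal u * g x + ereal v * g y) \<and>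
     (\<forall>z. g z \<le> Liminf (nhds z) g)}"

definition monotone_operator :: "('a::real_inner \<Rightarrow> 'a) \<Rightarrow> bool" where
  "monotone_operator F \<longleftrightarrow> (\<forall>x y. 0 \<le> (F x - F y) \<bullet> (x - y))"

text \<open>Set-valued operators are functions \<^typ>\<open>'a \<Rightarrow> 'a set\<close>; their sums are Minkowski sums.\<close>

definition zer :: "('a::zero \<Rightarrow> 'a set) \<Rightarrow> 'a set" where
  "zer A = {z. 0 \<in> A z}"

definition subdiff :: "('a::real_inner \<Rightarrow> ereal) \<Rightarrow> 'a \<Rightarrow> 'a set" where
  "subdiff g z = {p. \<forall>y. g z + ereal (p \<bullet> (y - z)) \<le> g y}"

definition normal_cone :: "'a::real_inner set \<Rightarrow> 'a \<Rightarrow> 'a set" where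
  "normal_cone C z = (if z \<in> C then {p. \<forall>z'\<in>C. p \<bullet> (z' - z) \<le> 0} else {})"

definition range_normal_cone :: "'a::real_inner set \<Rightarrow> 'a set" where
  "range_normal_cone C = (\<Union>z\<in>C. normal_cone C z)"

definition support_fn :: "'a::real_inner \<Rightarrow> 'a set \<Rightarrow> ereal" where
  "support_fn p C = (SUP z\<in>C. ereal (p \<bullet> z))"

definition prox :: "('a::real_inner \<Rightarrow> ereal) \<Rightarrow> 'a \<Rightarrow> 'a" where
  "prox G u = (ARG_MIN (\<lambda>z. G z + ereal ((norm (z - u))\<^sup>2 / 2)) z. True)"

text \<open>
  The bifunction \<open>H(z, y)\<close>. It is only meaningful for \<open>y \<in> edom g\<close>: in \<^typ>\<open>ereal\<close>,
  \<open>\<infinity> - \<infinity> = \<infinity>\<close>.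
\<close>

definition bifun :: "('a::real_inner \<Rightarrow> 'a) \<Rightarrow> ('a \<Rightarrow> ereal) \<Rightarrow> 'a \<Rightarrow> 'a \<Rightarrow> ereal" where
  "bifun F g z y = ereal (F y \<bullet> (z - y)) + g z - g y"

definition phi :: "('a::real_inner \<Rightarrow> 'a) \<Rightarrow> ('a \<Rightarrow> ereal) \<Rightarrow> 'a \<Rightarrow> 'a \<Rightarrow> ereal" where
  "phi F g z u = (SUP y\<in>edom g. bifun F g z y + ereal (y \<bullet> u))"

text \<open>
  The solution set of the upper-level variational inequality over \<open>S\<close>. The restriction to
  \<open>edom g\<close> only rules out the artefact \<open>\<infinity> - \<infinity> = \<infinity>\<close>; if \<open>S\<close> meets \<open>edom g\<close> it is implied by
  the inequality.
\<close>

definition hier_solutions :: "('a::real_inner \<Rightarrow> 'a) \<Rightarrow> ('a \<Rightarrow> ereal) \<Rightarrow> 'a set \<Rightarrow> 'a set" where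
  "hier_solutions F g S = {zs \<in> S \<inter> edom g. \<forall>z\<in>S. 0 \<le> bifun F g z zs}"

text \<open>
  With \<open>(F\<^sub>2, g\<^sub>2)\<close> and \<open>U\<close> this is the feasibility gap, with \<open>(F\<^sub>1, g\<^sub>1)\<close> and \<open>U \<inter> S\<^sub>2\<close> the
  optimality gap.
\<close>

definition gap :: "('a::real_inner \<Rightarrow> 'a) \<Rightarrow> ('a \<Rightarrow> ereal) \<Rightarrow> 'a \<Rightarrow> 'a set \<Rightarrow> ereal" where
  "gap F g z U = (SUP y\<in>U. bifun F g z y)"

definition weakly_sharp ::
  "('a::real_inner \<Rightarrow> 'a) \<Rightarrow> ('a \<Rightarrow> ereal) \<Rightarrow> 'a set \<Rightarrow> real \<Rightarrow> real \<Rightarrow> bool" where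
  "weakly_sharp F g S \<alpha> \<rho> \<longleftrightarrow> \<alpha> > 0 \<and> \<rho> \<ge> 1 \<and>
     (\<forall>zs\<in>S. \<forall>z\<in>edom g. bifun F g z zs \<ge> ereal (\<alpha> / \<rho> * infdist z S powr \<rho>))"

text \<open>
  The optimistic extragradient method: \<open>z k\<close> is the \<open>k\<close>-th main iterate for \<open>k \<ge> 1\<close> (the value
  \<open>z 0\<close> is unused), and \<open>w k\<close> is the half-step iterate of index \<open>k + 1/2\<close> for \<open>k \<ge> 0\<close>, so that
  \<open>w (k - 1)\<close> has index \<open>k - 1/2\<close>.
\<close>

definition optimistic_eg ::
  "('a::real_inner \<Rightarrow> 'a) \<Rightarrow> ('a \<Rightarrow> ereal) \<Rightarrow> ('a \<Rightarrow> 'a) \<Rightarrow> ('a \<Rightarrow> ereal) \<Rightarrow>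
   (nat \<Rightarrow> real) \<Rightarrow> (nat \<Rightarrow> real) \<Rightarrow> (nat \<Rightarrow> 'a) \<Rightarrow> (nat \<Rightarrow> 'a) \<Rightarrow> bool" where
  "optimistic_eg F1 g1 F2 g2 t \<sigma> z w \<longleftrightarrow>
     (let V = (\<lambda>k x. F2 x + \<sigma> k *\<^sub>R F1 x);
          G = (\<lambda>k x. g2 x + ereal (\<sigma> k) * g1 x);
          P = (\<lambda>k. prox (\<lambda>x. ereal (t k) * G k x))
      in z 1 = w 0 \<and>
         (\<forall>k\<ge>1. w k = P k (z k - t k *\<^sub>R V k (w (k - 1))) \<and>
                z (k + 1) = P k (z k - t k *\<^sub>R V k (w k))))"

end

theory Submission
  imports Defs
begin

text \<open>
  Fix \<open>x\<close> in the common domain \<open>D\<close>. The energy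
  \<open>E\<^sub>k(x) = \<parallel>z\<^sub>k - x\<parallel>\<^sup>2/2 + \<parallel>z\<^sub>k - w\<^sub>k\<^sub>-\<^sub>1\<parallel>\<^sup>2/8\<close> drives the whole proof. Adding the
  variational inequalities of the two proximal points of one iteration, and absorbing the error
  caused by evaluating the operator at the previous half step with the step size bound
  \<open>t\<^sub>k L\<^sub>k \<le> 1/4\<close>, yields
  \<open>t\<^sub>k (\<sigma>\<^sub>k H\<^sub>1(w\<^sub>k,x) - H\<^sub>2(x,w\<^sub>k)) \<le> E\<^sub>k(x) - E\<^sub>k\<^sub>+\<^sub>1(x)\<close>
  (\<open>energy_descent_mixed\<close>). Monotonicity of \<open>F\<^sub>2\<close> allows \<open>- H\<^sub>2(x,w\<^sub>k)\<close> to be replaced by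
  \<open>H\<^sub>2(w\<^sub>k,x)\<close> (\<open>energy_descent\<close>).

  The constants are uniform in \<open>K\<close> because the iterates are bounded. For compact \<open>D\<close> this is
  clear. Under the summability condition, take \<open>x\<close> to be a solution of the hierarchical problem:
  there \<open>0\<close> splits as \<open>F\<^sub>1(x) + q + p\<close> with \<open>q\<close> a subgradient of \<open>g\<^sub>1\<close> and \<open>p\<close> normal to \<open>S\<^sub>2\<close>, so
  \<open>H\<^sub>1(w,x) \<ge> - \<langle>p, w - x\<rangle>\<close>, and the possible increase of the energy in step \<open>k\<close> is at most the
  \<open>k\<close>-th term of the convergent series. It is essential here to use the mixed inequality, since the
  function \<open>\<phi>\<close> controls \<open>H\<^sub>2(x,w\<^sub>k)\<close> and not \<open>- H\<^sub>2(w\<^sub>k,x)\<close>.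

  Now \<open>H(\<cdot>,x)\<close> is convex, so Jensen's inequality passes from the iterates to their average.
  Summing the descent inequality and bounding \<open>H\<^sub>1(w\<^sub>k,x)\<close> from below gives the feasibility bound.
  For \<open>x \<in> S\<^sub>2\<close> one has \<open>H\<^sub>2(w\<^sub>k,x) \<ge> 0\<close>; dividing by \<open>\<sigma>\<^sub>k\<close> and summing by parts
  (\<open>weighted_telescope_le\<close>) gives the upper optimality bound. The lower one compares the average
  with a solution and its normal vector \<open>p\<close>: moving to a nearby point of \<open>S\<^sub>2\<close> costs at most
  \<open>\<parallel>p\<parallel>\<close> times the distance. Weak sharpness finally turns the feasibility bound into a bound on that
  distance.
\<close>

section \<open>Proper convex lower semicontinuous functions\<close>
abbreviation rval :: "('a \<Rightarrow> ereal) \<Rightarrow> 'a \<Rightarrow> real" where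
  "rval g x \<equiv> real_of_ereal (g x)"

lemma Gamma0_finite:
  assumes "g \<in> Gamma0" "x \<in> edom g"
  shows "g x = ereal (rval g x)"
  using assms by (cases "g x") (auto simp: Gamma0_def edom_def)

lemma not_edom_infinite:
  assumes "x \<notin> edom g"
  shows "g x = \<infinity>"
  using assms by (auto simp: edom_def)

text \<open>
  Only points of the effective domain are averaged, so the inequality in \<^typ>\<open>ereal\<close> has a finite
  right-hand side. This gives access to the library's theory of real convex functions.
\<close>
lemma Gamma0_convex_on:
  assumes "g \<in> Gamma0"
  shows "convex_on (edom g) (rval g)"
proof -
  have ineq: "g (u *\<^sub>R x + v *\<^sub>R y) \<le> ereal (u * rval g x + v * rval g y)"
    if "x \<in> edom g" "y \<in> edom g" "u \<ge> 0" "v \<ge> 0" "u + v = 1" for x y u v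
  proof -
    have "g (u *\<^sub>R x + v *\<^sub>R y) \<le> ereal u * g x + ereal v * g y"
      using assms that by (auto simp: Gamma0_def)
    then show ?thesis
      using Gamma0_finite[OF assms that(1)] Gamma0_finite[OF assms that(2)]
      by (metis plus_ereal.simps(1) times_ereal.simps(1))
  qed
  then have cv: "convex (edom g)"
    unfolding convex_def edom_def by (fastforce intro: le_less_trans)
  show ?thesis
    unfolding convex_on_def
  proof (intro conjI cv ballI allI impI)
    fix x y and u v :: real
    assume *: "x \<in> edom g" "y \<in> edom g" "0 \<le> u" "0 \<le> v" "u + v = 1"
    then have "u *\<^sub>R x + v *\<^sub>R y \<in> edom g"
      using cv by (auto simp: convex_def)
    from Gamma0_finite[OF assms this] ineq[OF *]
    show "rval g (u *\<^sub>R x + v *\<^sub>R y) \<le> u * rval g x + v * rval g y"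
      by (metis ereal_less_eq(3))
  qed
qed

lemma Gamma0_lsc_eventually:
  assumes "g \<in> Gamma0" "y < g x"
  shows "eventually (\<lambda>z. y < g z) (nhds x)"
  using assms unfolding Gamma0_def by (auto simp: le_Liminf_iff)

lemma edom_add_scaled:
  assumes "g \<in> Gamma0" "h \<in> Gamma0" "s > 0"
  shows "edom (\<lambda>x. g x + ereal s * h x) = edom g \<inter> edom h"
proof -
  have "g x + ereal s * h x < \<infinity> \<longleftrightarrow> g x < \<infinity> \<and> h x < \<infinity>" for x
    using assms by (cases "g x"; cases "h x") (auto simp: Gamma0_def)
  then show ?thesis
    by (auto simp: edom_def)
qed

lemma Gamma0_scale:
  assumes "g \<in> Gamma0" "s > 0"
  shows "(\<lambda>x. ereal s * g x) \<in> Gamma0"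
proof -
  have "ereal s * g x \<noteq> -\<infinity>" for x
    using assms by (cases "g x") (auto simp: Gamma0_def)
  moreover have "ereal s * g x < \<infinity> \<longleftrightarrow> g x < \<infinity>" for x
    using assms by (cases "g x") (auto simp: Gamma0_def)
  moreover have "edom g \<noteq> {}"
    using assms by (auto simp: Gamma0_def)
  moreover have "ereal s * g (u *\<^sub>R x + v *\<^sub>R y) \<le> ereal u * (ereal s * g x) + ereal v * (ereal s * g y)"
    if "u \<ge> 0" "v \<ge> 0" "u + v = 1" for x y u v
  proof -
    have "ereal s * g (u *\<^sub>R x + v *\<^sub>R y) \<le> ereal s * (ereal u * g x + ereal v * g y)"
      using assms that by (intro ereal_mult_left_mono) (auto simp: Gamma0_def)
    also have "\<dots> = ereal u * (ereal s * g x) + ereal v * (ereal s * g y)"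
      using assms(2) by (subst ereal_pos_distrib) (auto simp: ac_simps)
    finally show ?thesis .
  qed
  moreover have "ereal s * g x \<le> Liminf (nhds x) (\<lambda>x. ereal s * g x)" for x
    using assms
    by (subst Liminf_ereal_mult_left) (auto simp: Gamma0_def intro!: ereal_mult_left_mono)
  ultimately show ?thesis
    unfolding Gamma0_def edom_def by auto
qed

lemma Gamma0_add:
  assumes g: "g \<in> Gamma0" and h: "h \<in> Gamma0" and ne: "edom g \<inter> edom h \<noteq> {}"
  shows "(\<lambda>x. g x + h x) \<in> Gamma0"
proof -
  have fin: "g x \<noteq> -\<infinity>" "h x \<noteq> -\<infinity>" for x
    using g h by (auto simp: Gamma0_def)
  have "g x + h x \<noteq> -\<infinity>" for x
    using fin[of x] by (cases "g x"; cases "h x") auto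
  moreover have "edom (\<lambda>x. g x + h x) \<noteq> {}"
    using ne by (auto simp: edom_def)
  moreover have "g (u *\<^sub>R x + v *\<^sub>R y) + h (u *\<^sub>R x + v *\<^sub>R y)
      \<le> ereal u * (g x + h x) + ereal v * (g y + h y)"
    if "u \<ge> 0" "v \<ge> 0" "u + v = 1" for x y u v
  proof -
    have "g (u *\<^sub>R x + v *\<^sub>R y) + h (u *\<^sub>R x + v *\<^sub>R y)
        \<le> (ereal u * g x + ereal v * g y) + (ereal u * h x + ereal v * h y)"
      using g h that by (intro add_mono) (auto simp: Gamma0_def)
    also have "\<dots> = ereal u * (g x + h x) + ereal v * (g y + h y)"
      using that by (simp add: ereal_pos_distrib ac_simps)
    finally show ?thesis .
  qed
  moreover have "g x + h x \<le> Liminf (nhds x) (\<lambda>x. g x + h x)" for x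
    unfolding le_Liminf_iff
  proof (intro allI impI)
    fix y assume y: "y < g x + h x"
    show "eventually (\<lambda>z. y < g z + h z) (nhds x)"
    proof (cases y)
      case (real r)
      \<comment> \<open>split the strict bound on the sum into strict bounds on the two summands\<close>
      obtain a b where ab: "ereal a < g x" "ereal b < h x" "r = a + b"
      proof (cases "g x")
        case (real gx)
        note gx = this
        show ?thesis
        proof (cases "h x")
          case (real hx)
          with gx y \<open>y = ereal r\<close> that[of "gx - (gx + hx - r) / 2" "hx - (gx + hx - r) / 2"] show ?thesis
            by (auto simp: field_simps)
        qed (use that[of "gx - 1" "r - gx + 1"] gx fin in auto)
      next
        case PInf
        note gx = this
        show ?thesis
        proof (cases "h x")
          case (real hx)
          with gx that[of "r - hx + 1" "hx - 1"] show ?thesis by auto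
        qed (use that[of 0 r] gx fin in auto)
      qed (use fin in auto)
      have "eventually (\<lambda>z. ereal a < g z) (nhds x)" "eventually (\<lambda>z. ereal b < h z) (nhds x)"
        using ab g h by (auto intro: Gamma0_lsc_eventually)
      then show ?thesis
      proof eventually_elim
        case (elim z)
        then show ?case
          using ereal_add_strict_mono2[of "ereal a" "g z" "ereal b" "h z"] ab real by simp
      qed
    next
      case MInf
      have "y < g z + h z" for z
        using fin[of z] MInf by (cases "g z"; cases "h z") auto
      then show ?thesis by simp
    qed (use y in auto)
  qed
  ultimately show ?thesis
    unfolding Gamma0_def by blast
qed

section \<open>The proximal operator\<close>
text \<open>
  The quadratic term makes the objective strongly convex. Comparing two points with their midpoint
  shows that nearly minimal points are close together, so minimising sequences are Cauchy, and
  lower semicontinuity passes to the limit. No weak compactness is involved; the affine minorant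
  makes the infimum finite.
\<close>
lemma prox_objective_attains_min:
  fixes G :: "'a::{real_inner, complete_space} \<Rightarrow> ereal"
  assumes G: "G \<in> Gamma0" and minorant: "\<And>z. ereal (p \<bullet> z + c) \<le> G z"
  shows "\<exists>m\<in>edom G. \<forall>x\<in>edom G.
    rval G m + (norm (m - u))\<^sup>2 / 2 \<le> rval G x + (norm (x - u))\<^sup>2 / 2"
proof -
  define f where "f = (\<lambda>z. rval G z + (norm (z - u))\<^sup>2 / 2)"
  have ne: "edom G \<noteq> {}" using G by (auto simp: Gamma0_def)
  have cvx: "convex_on (edom G) (rval G)" by (rule Gamma0_convex_on[OF G])
  have below: "c + p \<bullet> u - (norm p)\<^sup>2 / 2 \<le> f z" if "z \<in> edom G" for z
  proof -
    have "p \<bullet> z + c \<le> rval G z"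
      using minorant[of z] Gamma0_finite[OF G that] by (metis ereal_less_eq(3))
    moreover have "0 \<le> (norm (p + (z - u)))\<^sup>2" by simp
    then have "0 \<le> (norm p)\<^sup>2 + 2 * (p \<bullet> z - p \<bullet> u) + (norm (z - u))\<^sup>2"
      by (simp add: power2_norm_eq_inner inner_add inner_diff inner_commute algebra_simps)
    ultimately show ?thesis
      unfolding f_def by (simp add: field_simps)
  qed
  define i where "i = Inf (f ` edom G)"
  have bdd: "bdd_below (f ` edom G)" by (rule bdd_belowI2[of _ "c + p \<bullet> u - (norm p)\<^sup>2 / 2"]) (rule below)
  have i_le: "i \<le> f z" if "z \<in> edom G" for z
    unfolding i_def using bdd that by (intro cInf_lower) auto
  have "\<exists>z\<in>edom G. f z < i + 1 / real (Suc n)" for n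
    using cInf_lessD[of "f ` edom G" "i + 1 / real (Suc n)"] ne unfolding i_def by auto
  then obtain X where X: "\<And>n. X n \<in> edom G" "\<And>n. f (X n) < i + 1 / real (Suc n)"
    by metis
  \<comment> \<open>parallelogram identity: the excess of the two values over the infimum controls the distance\<close>
  have mid: "(norm (x - y))\<^sup>2 / 8 \<le> (f x - i) / 2 + (f y - i) / 2"
    if "x \<in> edom G" "y \<in> edom G" for x y
  proof -
    let ?m = "(1/2) *\<^sub>R x + (1/2) *\<^sub>R y"
    have "?m \<in> edom G"
      using convex_on_imp_convex[OF cvx] that by (auto simp: convex_def)
    then have "i \<le> f ?m" by (rule i_le)
    also have "f ?m \<le> (rval G x + rval G y) / 2 + (norm (?m - u))\<^sup>2 / 2"
      using convex_onD[OF cvx, of "1/2" x y] that unfolding f_def by (simp add: field_simps)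
    also have "(norm (?m - u))\<^sup>2 = (norm (x - u))\<^sup>2 / 2 + (norm (y - u))\<^sup>2 / 2 - (norm (x - y))\<^sup>2 / 4"
      by (simp add: power2_norm_eq_inner inner_add inner_diff inner_commute field_simps)
    finally show ?thesis unfolding f_def by (simp add: field_simps)
  qed
  have "Cauchy X"
  proof (rule metric_CauchyI)
    fix e :: real assume e: "e > 0"
    obtain N where N: "8 / e\<^sup>2 < real N" using reals_Archimedean2 by blast
    have "dist (X m) (X n) < e" if "m \<ge> N" "n \<ge> N" for m n
    proof -
      have Npos: "real N > 0" using N e by (smt (verit) divide_pos_pos zero_less_power)
      have half: "s < c" if "s \<le> a / 2 + b / 2" "a < c" "b < c" for s a b c :: real
        using that by linarith
      have "f (X m) - i < 1 / real N" "f (X n) - i < 1 / real N"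
        using X(2)[of m] X(2)[of n] that Npos frac_le[of 1 1 "real N" "real (Suc m)"]
          frac_le[of 1 1 "real N" "real (Suc n)"] by auto
      then have "(norm (X m - X n))\<^sup>2 / 8 < 1 / real N"
        by (rule half[OF mid[OF X(1) X(1)]])
      also have "1 / real N < e\<^sup>2 / 8" using N e Npos by (simp add: field_simps)
      finally have "(norm (X m - X n))\<^sup>2 < e\<^sup>2" by simp
      then show ?thesis using e by (simp add: dist_norm power2_less_imp_less)
    qed
    then show "\<exists>N. \<forall>m\<ge>N. \<forall>n\<ge>N. dist (X m) (X n) < e" by blast
  qed
  then obtain m where m: "X \<longlonglongrightarrow> m"
    using Cauchy_convergent_iff convergent_def by blast
  have lim: "(\<lambda>n. i + 1 / real (Suc n) - (norm (X n - u))\<^sup>2 / 2) \<longlonglongrightarrow> i + 0 - (norm (m - u))\<^sup>2 / 2"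
    by (intro tendsto_intros m LIMSEQ_Suc[OF lim_1_over_n]) auto
  have le: "G m \<le> ereal (i - (norm (m - u))\<^sup>2 / 2)"
  proof (rule ccontr)
    assume "\<not> ?thesis"
    then have "ereal (i - (norm (m - u))\<^sup>2 / 2) < G m" by simp
    then obtain y where y: "i - (norm (m - u))\<^sup>2 / 2 < y" "ereal y < G m"
      using ereal_dense2[of "ereal (i - (norm (m - u))\<^sup>2 / 2)" "G m"] by auto
    have "eventually (\<lambda>n. ereal y < G (X n)) sequentially"
      using Gamma0_lsc_eventually[OF G y(2)] m by (rule eventually_compose_filterlim)
    then have "eventually (\<lambda>n. y \<le> i + 1 / real (Suc n) - (norm (X n - u))\<^sup>2 / 2) sequentially"
    proof eventually_elim
      case (elim n)
      then have "y < rval G (X n)"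
        using Gamma0_finite[OF G X(1)[of n]] by (metis less_ereal.simps(1))
      then show ?case using X(2)[of n] unfolding f_def by simp
    qed
    then have "y \<le> i + 0 - (norm (m - u))\<^sup>2 / 2"
      using lim by (intro tendsto_lowerbound) auto
    then show False using y by simp
  qed
  then have md: "m \<in> edom G" by (auto simp: edom_def intro: le_less_trans)
  then have "f m \<le> i"
    using le Gamma0_finite[OF G md] unfolding f_def by (metis ereal_less_eq(3) le_diff_eq)
  then show ?thesis using md i_le unfolding f_def by (meson order_trans)
qed

text \<open>
  The second claim is the first-order optimality condition
  \<open>u - prox G u \<in> \<partial>G (prox G u)\<close>, restricted to the effective domain to stay with real numbers.
\<close>
lemma prox_variational:
  fixes G :: "'a::{real_inner, complete_space} \<Rightarrow> ereal"
  assumes G: "G \<in> Gamma0" and minorant: "\<And>z. ereal (p \<bullet> z + c) \<le> G z"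
  shows "prox G u \<in> edom G"
    and "x \<in> edom G \<Longrightarrow> rval G (prox G u) - rval G x \<le> (u - prox G u) \<bullet> (prox G u - x)"
proof -
  define f where "f = (\<lambda>z. G z + ereal ((norm (z - u))\<^sup>2 / 2))"
  obtain m where m: "m \<in> edom G"
    "\<And>x. x \<in> edom G \<Longrightarrow> rval G m + (norm (m - u))\<^sup>2 / 2 \<le> rval G x + (norm (x - u))\<^sup>2 / 2"
    using prox_objective_attains_min[OF G minorant] by blast
  have fd: "f z = ereal (rval G z + (norm (z - u))\<^sup>2 / 2)" if "z \<in> edom G" for z
    unfolding f_def using Gamma0_finite[OF G that] by (metis plus_ereal.simps(1))
  have fi: "f z = \<infinity>" if "z \<notin> edom G" for z
    unfolding f_def using not_edom_infinite[OF that] by simp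
  have "is_arg_min f (\<lambda>_. True) m"
    unfolding is_arg_min_def
  proof (intro conjI notI TrueI)
    assume "\<exists>y. True \<and> f y < f m"
    then obtain y where y: "f y < f m" by blast
    then have "y \<in> edom G" using fi[of y] by (cases "y \<in> edom G") auto
    then show False using y m fd by fastforce
  qed
  then have "is_arg_min f (\<lambda>_. True) (prox G u)"
    unfolding prox_def f_def[symmetric] arg_min_def by (rule someI)
  then have opt: "f (prox G u) \<le> f x" for x
    by (auto simp: is_arg_min_def not_less)
  show pd: "prox G u \<in> edom G"
    using opt[of m] fd[OF m(1)] fi[of "prox G u"] by fastforce
  assume x: "x \<in> edom G"
  let ?q = "prox G u"
  let ?d = "rval G ?q - rval G x - (u - ?q) \<bullet> (?q - x)"
  \<comment> \<open>compare with the points of the segment from the minimiser to \<open>x\<close>\<close>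
  have seg: "?d \<le> l * ((norm (x - ?q))\<^sup>2 / 2)" if l: "0 < l" "l < 1" for l
  proof -
    let ?y = "(1 - l) *\<^sub>R ?q + l *\<^sub>R x"
    have cvx: "convex_on (edom G) (rval G)" by (rule Gamma0_convex_on[OF G])
    then have "?y \<in> edom G"
      using convex_on_imp_convex[OF cvx] x pd l by (auto simp: convex_def)
    then have "rval G ?q + (norm (?q - u))\<^sup>2 / 2 \<le> rval G ?y + (norm (?y - u))\<^sup>2 / 2"
      using opt[of ?y] fd pd by simp
    also have "rval G ?y \<le> (1 - l) * rval G ?q + l * rval G x"
      using convex_onD[OF cvx, of l ?q x] x pd l by simp
    also have "(norm (?y - u))\<^sup>2 = (norm (?q - u))\<^sup>2 - 2 * l * ((u - ?q) \<bullet> (x - ?q)) + l\<^sup>2 * (norm (x - ?q))\<^sup>2"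
      unfolding power2_norm_eq_inner power2_eq_square[of l]
      by (simp add: inner_add inner_diff inner_commute algebra_simps)
    finally have "l * ?d \<le> l * (l * ((norm (x - ?q))\<^sup>2 / 2))"
      by (simp add: field_simps inner_diff power2_eq_square)
    then show ?thesis using l by simp
  qed
  have "((\<lambda>l. l * ((norm (x - ?q))\<^sup>2 / 2)) \<longlongrightarrow> 0 * ((norm (x - ?q))\<^sup>2 / 2)) (at_right (0::real))"
    by (intro tendsto_intros)
  moreover have "eventually (\<lambda>l::real. 0 < l \<and> l < 1) (at_right 0)"
    unfolding eventually_at_right_field by (intro exI[of _ 1]) auto
  then have "eventually (\<lambda>l. ?d \<le> l * ((norm (x - ?q))\<^sup>2 / 2)) (at_right (0::real))"
    by eventually_elim (use seg in auto)
  ultimately have "?d \<le> 0 * ((norm (x - ?q))\<^sup>2 / 2)"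
    by (rule tendsto_lowerbound) simp
  then show "rval G ?q - rval G x \<le> (u - ?q) \<bullet> (?q - x)" by simp
qed

section \<open>The bifunction as a real number\<close>
text \<open>
  The bifunction with real values, in which sums and averages can be computed freely. Off the
  effective domain \<^const>\<open>real_of_ereal\<close> sends \<open>\<infinity>\<close> to \<open>0\<close>, so it is meaningful only when both
  arguments lie in the domain.
\<close>
definition rbifun :: "('a::real_inner \<Rightarrow> 'a) \<Rightarrow> ('a \<Rightarrow> ereal) \<Rightarrow> 'a \<Rightarrow> 'a \<Rightarrow> real" where
  "rbifun F g z y = F y \<bullet> (z - y) + rval g z - rval g y"

lemma bifun_eq_rbifun:
  assumes "g \<in> Gamma0" "z \<in> edom g" "y \<in> edom g"
  shows "bifun F g z y = ereal (rbifun F g z y)"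
  unfolding bifun_def rbifun_def
  using Gamma0_finite[OF assms(1,2)] Gamma0_finite[OF assms(1,3)]
  by (metis ereal_minus(1) plus_ereal.simps(1))

lemma rbifun_monotone:
  assumes "monotone_operator F"
  shows "rbifun F g z y \<le> - rbifun F g y z"
proof -
  have "0 \<le> (F z - F y) \<bullet> (z - y)"
    using assms by (auto simp: monotone_operator_def)
  then show ?thesis
    unfolding rbifun_def by (simp add: inner_diff algebra_simps)
qed

text \<open>
  The subgradient inequality for \<open>g\<close> at \<open>y\<close>. It is applied with \<open>F y + q = 0\<close> at the lower level
  and with \<open>F y + q\<close> the negative of a normal vector at the upper level.
\<close>
lemma rbifun_subgradient:
  assumes g: "g \<in> Gamma0" "q \<in> subdiff g y" "y \<in> edom g" "z \<in> edom g"
  shows "(F y + q) \<bullet> (z - y) \<le> rbifun F g z y"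
proof -
  have "g y + ereal (q \<bullet> (z - y)) \<le> g z"
    using assms by (auto simp: subdiff_def)
  then have "rval g y + q \<bullet> (z - y) \<le> rval g z"
    using Gamma0_finite[OF g(1,3)] Gamma0_finite[OF g(1,4)]
    by (metis ereal_less_eq(3) plus_ereal.simps(1))
  then show ?thesis
    unfolding rbifun_def by (simp add: inner_add)
qed

lemma subdiff_edom:
  assumes "g \<in> Gamma0" "q \<in> subdiff g y"
  shows "y \<in> edom g"
proof -
  obtain x where "x \<in> edom g" using assms by (auto simp: Gamma0_def)
  moreover have "g y + ereal (q \<bullet> (x - y)) \<le> g x" using assms by (auto simp: subdiff_def)
  ultimately show ?thesis by (cases "g y") (auto simp: edom_def)
qed

lemma subdiff_affine_minorant:
  assumes "g \<in> Gamma0" "q \<in> subdiff g y"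
  shows "ereal (q \<bullet> z + (rval g y - q \<bullet> y)) \<le> g z"
proof -
  have "g y + ereal (q \<bullet> (z - y)) \<le> g z" using assms by (auto simp: subdiff_def)
  moreover have "g y = ereal (rval g y)"
    using assms by (intro Gamma0_finite subdiff_edom)
  ultimately have "ereal (rval g y) + ereal (q \<bullet> (z - y)) \<le> g z" by simp
  then show ?thesis by (simp add: inner_diff algebra_simps)
qed

text \<open>
  Jensen's inequality: in its first argument the bifunction is an affine function plus \<open>g\<close>.
\<close>
lemma rbifun_average_le:
  fixes w :: "nat \<Rightarrow> 'a::real_inner"
  assumes g: "g \<in> Gamma0" and fin: "finite I" "I \<noteq> {}"
    and w: "\<And>k. k \<in> I \<Longrightarrow> w k \<in> edom g" and t: "\<And>k. k \<in> I \<Longrightarrow> t k > 0"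
  shows "sum t I * rbifun F g ((1 / sum t I) *\<^sub>R (\<Sum>k\<in>I. t k *\<^sub>R w k)) y
    \<le> (\<Sum>k\<in>I. t k * rbifun F g (w k) y)"
proof -
  have T: "sum t I > 0" using fin t by (intro sum_pos) auto
  have avg: "(1 / sum t I) *\<^sub>R (\<Sum>k\<in>I. t k *\<^sub>R w k) = (\<Sum>k\<in>I. (t k / sum t I) *\<^sub>R w k)"
    by (simp add: scaleR_sum_right)
  have one: "(\<Sum>k\<in>I. t k / sum t I) = 1"
    using T by (simp add: sum_divide_distrib[symmetric])
  have "rval g (\<Sum>k\<in>I. (t k / sum t I) *\<^sub>R w k) \<le> (\<Sum>k\<in>I. t k / sum t I * rval g (w k))"
    using fin T t w
    by (intro convex_on_sum[OF _ _ Gamma0_convex_on[OF g] one]) (auto intro: less_imp_le)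
  then have "sum t I * rval g (\<Sum>k\<in>I. (t k / sum t I) *\<^sub>R w k)
      \<le> sum t I * (\<Sum>k\<in>I. t k / sum t I * rval g (w k))"
    using T by (intro mult_left_mono) auto
  also have "\<dots> = (\<Sum>k\<in>I. t k * rval g (w k))"
    using T by (simp add: sum_distrib_left)
  finally have 1: "sum t I * rval g (\<Sum>k\<in>I. (t k / sum t I) *\<^sub>R w k) \<le> (\<Sum>k\<in>I. t k * rval g (w k))" .
  have 2: "sum t I * (F y \<bullet> (\<Sum>k\<in>I. (t k / sum t I) *\<^sub>R w k)) = (\<Sum>k\<in>I. t k * (F y \<bullet> w k))"
    using T by (simp add: inner_sum_right sum_distrib_left)
  have 3: "(\<Sum>k\<in>I. t k * rbifun F g (w k) y)
      = (\<Sum>k\<in>I. t k * (F y \<bullet> w k)) + (\<Sum>k\<in>I. t k * rval g (w k)) - sum t I * (F y \<bullet> y + rval g y)"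
  proof -
    have "t k * rbifun F g (w k) y
        = t k * (F y \<bullet> w k) + t k * rval g (w k) - t k * (F y \<bullet> y + rval g y)" for k
      unfolding rbifun_def by (simp add: inner_diff algebra_simps)
    then show ?thesis
      by (simp only: sum.distrib sum_subtractf sum_distrib_right)
  qed
  show ?thesis
    unfolding avg 3 using 1 2 by (simp add: rbifun_def inner_diff algebra_simps)
qed

section \<open>One extragradient step and summation by parts\<close>
text \<open>
  The half step is tested at the full step \<open>z'\<close>, the full step at \<open>x\<close>. In the sum the
  three-point identity produces the squared distances, and all that remains is the pairing of
  \<open>v - v0\<close> with \<open>w - z'\<close>. Its bound involves \<open>z - w0\<close>, which is the distance left
  over from the previous iteration; this is why the weight \<open>1/8\<close> of the memory term reproduces
  itself.
\<close>
lemma optimistic_step_descent: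
  fixes z z' w w0 x v v0 :: "'a::real_inner"
  assumes half: "t * (Gw - Gz') \<le> (z - t *\<^sub>R v0 - w) \<bullet> (w - z')"
    and full: "t * (Gz' - Gx) \<le> (z - t *\<^sub>R v - z') \<bullet> (z' - x)"
    and lip: "norm (v - v0) \<le> L * norm (w - w0)" "L \<ge> 0"
    and t: "t \<ge> 0" "16 * t\<^sup>2 * L\<^sup>2 \<le> 1"
  shows "t * (v \<bullet> (w - x) + Gw - Gx)
    \<le> ((norm (z - x))\<^sup>2 / 2 + (norm (z - w0))\<^sup>2 / 8) - ((norm (z' - x))\<^sup>2 / 2 + (norm (z' - w))\<^sup>2 / 8)"
proof -
  let ?a = "norm (z - w)" and ?c = "norm (z - w0)" and ?b = "norm (z' - w)"
  have "(4 * (t * L))\<^sup>2 \<le> 1\<^sup>2" using t by (simp add: power_mult_distrib mult.assoc)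
  then have "4 * (t * L) \<le> 1" by (rule power2_le_imp_le) simp
  then have tL: "t * L \<le> 1 / 4" by simp
  have "t * ((v - v0) \<bullet> (w - z')) \<le> t * (norm (v - v0) * norm (w - z'))"
    using t by (intro mult_left_mono norm_cauchy_schwarz) auto
  also have "\<dots> \<le> t * ((L * norm (w - w0)) * ?b)"
    using t lip by (intro mult_left_mono mult_mono) (auto simp: norm_minus_commute)
  also have "\<dots> = (t * L) * (norm (w - w0) * ?b)" by simp
  also have "\<dots> \<le> 1 / 4 * ((?a + ?c) * ?b)"
  proof (intro mult_mono tL)
    show "norm (w - w0) \<le> ?a + ?c"
      using norm_triangle_ineq[of "w - z" "z - w0"] by (simp add: norm_minus_commute)
  qed (use t lip in auto)
  also have "\<dots> \<le> (?a\<^sup>2 + ?c\<^sup>2 + 2 * ?b\<^sup>2) / 8"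
    using zero_le_power2[of "?a - ?b"] zero_le_power2[of "?c - ?b"]
    by (simp add: power2_eq_square algebra_simps)
  finally have cross: "t * ((v - v0) \<bullet> (w - z')) \<le> (?a\<^sup>2 + ?c\<^sup>2 + 2 * ?b\<^sup>2) / 8" .
  have ident: "(z - t *\<^sub>R v0 - w) \<bullet> (w - z') + (z - t *\<^sub>R v - z') \<bullet> (z' - x) + t * (v \<bullet> (w - x))
      = (norm (z - x))\<^sup>2 / 2 - (norm (z' - x))\<^sup>2 / 2 - ?a\<^sup>2 / 2 - ?b\<^sup>2 / 2 + t * ((v - v0) \<bullet> (w - z'))"
    unfolding power2_norm_eq_inner
    by (simp add: inner_add inner_diff inner_commute field_simps)
  have "t * (v \<bullet> (w - x) + Gw - Gx)
      = t * (Gw - Gz') + t * (Gz' - Gx) + t * (v \<bullet> (w - x))"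
    by (simp add: algebra_simps)
  then have "t * (v \<bullet> (w - x) + Gw - Gx)
      \<le> (norm (z - x))\<^sup>2 / 2 - (norm (z' - x))\<^sup>2 / 2 - ?a\<^sup>2 / 2 - ?b\<^sup>2 / 2 + (?a\<^sup>2 + ?c\<^sup>2 + 2 * ?b\<^sup>2) / 8"
    using half full cross ident by linarith
  also have "\<dots> \<le> ((norm (z - x))\<^sup>2 / 2 + ?c\<^sup>2 / 8) - ((norm (z' - x))\<^sup>2 / 2 + ?b\<^sup>2 / 8)"
  proof -
    have arith: "p / 2 - q / 2 - a / 2 - b / 2 + (a + c + 2 * b) / 8 \<le> (p / 2 + c / 8) - (q / 2 + b / 8)"
      if "0 \<le> a" "0 \<le> b" for a b c p q :: real
      using that by (simp add: field_simps)
    show ?thesis by (rule arith) simp_all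
  qed
  finally show ?thesis .
qed

text \<open>
  Summation by parts: the weights \<open>1 / s k\<close> increase and the numbers \<open>M - e k\<close> are nonnegative, so
  the weight of each of them may be raised to the next one.
\<close>
lemma weighted_telescope_le:
  fixes e s :: "nat \<Rightarrow> real"
  assumes s: "\<And>k. k \<ge> 1 \<Longrightarrow> s k > 0" "\<And>k. k \<ge> 1 \<Longrightarrow> s (k + 1) \<le> s k"
    and e: "\<And>k. k \<ge> 1 \<Longrightarrow> e k \<le> M" and K: "K \<ge> 1"
  shows "(\<Sum>k=1..K. (e k - e (k + 1)) / s k) \<le> (M - e (K + 1)) / s K"
  using K
proof (induction K rule: nat_induct_at_least)
  case base
  then show ?case using s(1)[of 1] e[of 1] by (simp add: divide_right_mono)
next
  case (Suc K)
  have "(M - e (K + 1)) / s K \<le> (M - e (K + 1)) / s (K + 1)"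
    using s e Suc.hyps by (intro divide_left_mono) auto
  then have "(\<Sum>k=1..Suc K. (e k - e (k + 1)) / s k)
      \<le> (M - e (K + 1)) / s (K + 1) + (e (K + 1) - e (K + 2)) / s (K + 1)"
    using Suc.IH by simp
  also have "\<dots> = (M - e (K + 2)) / s (K + 1)" by (simp add: add_divide_distrib[symmetric])
  finally show ?case by simp
qed

section \<open>The hierarchical problem and its solutions\<close>
locale hierarchical_oeg =
  fixes F1 F2 :: "'a::{real_inner, polish_space} \<Rightarrow> 'a"
    and g1 g2 :: "'a \<Rightarrow> ereal"
    and L1 L2 :: real
    and S1 S2 D :: "'a set"
    and t \<sigma> T TS :: "nat \<Rightarrow> real"
    and z w zbar :: "nat \<Rightarrow> 'a"
  assumes F1: "monotone_operator F1" "L1-lipschitz_on UNIV F1"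
    and F2: "monotone_operator F2" "L2-lipschitz_on UNIV F2"
    and g: "g1 \<in> Gamma0" "g2 \<in> Gamma0"
    and D: "D = edom g1 \<inter> edom g2"
    and S2: "S2 = zer (\<lambda>x. F2 x +o subdiff g2 x)"
    and S1: "S1 = zer (\<lambda>x. F1 x +o (subdiff g1 x + normal_cone S2 x))" "S1 \<noteq> {}"
    and osc: "\<forall>A B. compact A \<longrightarrow> compact B \<longrightarrow> A \<subseteq> D \<longrightarrow> B \<subseteq> D \<longrightarrow>
      (SUP (x, y)\<in>A \<times> B. \<bar>g1 x - g1 y\<bar>) < \<infinity>"
    and pos: "\<forall>k\<ge>1. t k > 0" "\<forall>k\<ge>1. \<sigma> k > 0"
    and decr: "\<forall>k\<ge>1. \<sigma> (k + 1) \<le> \<sigma> k"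
    and T: "T = (\<lambda>K. \<Sum>k=1..K. t k)"
    and TS: "TS = (\<lambda>K. \<Sum>k=1..K. t k * \<sigma> k)"
    and alt:
      "(\<forall>p\<in>range_normal_cone S2.
          (\<Sum>n. ereal (t (Suc n)) *
             ((SUP x\<in>S2. phi F2 g2 x (\<sigma> (Suc n) *\<^sub>R p)) - support_fn (\<sigma> (Suc n) *\<^sub>R p) S2)) < \<infinity>)
       \<or> compact D"
    and iter: "optimistic_eg F1 g1 F2 g2 t \<sigma> z w"
    and step: "\<forall>k\<ge>1. 16 * (t k)\<^sup>2 * (L2 + \<sigma> k * L1)\<^sup>2 \<le> 1"
    and zbar: "zbar = (\<lambda>K. (1 / T K) *\<^sub>R (\<Sum>k=1..K. t k *\<^sub>R w k))"
begin

lemma convex_D: "convex D"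
  unfolding D using g by (intro convex_Int convex_on_imp_convex[OF Gamma0_convex_on])

lemma S2_subgradient:
  assumes "y \<in> S2"
  shows "- F2 y \<in> subdiff g2 y"
proof -
  obtain q where "q \<in> subdiff g2 y" "0 = F2 y + q"
    using assms unfolding S2 zer_def elt_set_plus_def by auto
  then show ?thesis by (metis add.inverse_unique)
qed

lemma S2_edom: "y \<in> S2 \<Longrightarrow> y \<in> edom g2"
  using S2_subgradient subdiff_edom g by blast

lemma feasibility_bifun_nonneg:
  assumes "y \<in> S2" "x \<in> edom g2"
  shows "0 \<le> rbifun F2 g2 x y"
  using rbifun_subgradient[OF g(2) S2_subgradient[OF assms(1)] S2_edom[OF assms(1)] assms(2), of F2]
  by simp

lemma S1_decomposition:
  assumes "y \<in> S1"
  obtains p q where "y \<in> S2" "p \<in> normal_cone S2 y" "q \<in> subdiff g1 y" "F1 y + q = - p"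
proof -
  obtain q p where *: "q \<in> subdiff g1 y" "p \<in> normal_cone S2 y" "0 = F1 y + (q + p)"
    using assms unfolding S1(1) zer_def elt_set_plus_def set_plus_def by auto
  moreover have "y \<in> S2" using *(2) by (auto simp: normal_cone_def split: if_splits)
  moreover have "F1 y + q = - p" using *(3) by (metis add.assoc eq_neg_iff_add_eq_0)
  ultimately show ?thesis using that by blast
qed

text \<open>
  The inclusion \<open>0 \<in> F\<^sub>1(y) + \<partial>g\<^sub>1(y) + N(y)\<close>, with \<open>N\<close> the normal cone of \<open>S\<^sub>2\<close>, read as a lower
  bound for the upper-level bifunction that, unlike the defining variational inequality, also holds
  outside \<open>S\<^sub>2\<close>.
\<close>
lemma S1_normal_vector:
  assumes "y \<in> S1"
  obtains p where "y \<in> S2" "y \<in> D" "p \<in> normal_cone S2 y"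
    "\<And>x. x \<in> edom g1 \<Longrightarrow> - (p \<bullet> (x - y)) \<le> rbifun F1 g1 x y"
proof -
  obtain p q where *: "y \<in> S2" "p \<in> normal_cone S2 y" "q \<in> subdiff g1 y" "F1 y + q = - p"
    using S1_decomposition[OF assms] .
  have "y \<in> edom g1" using *(3) subdiff_edom g by blast
  moreover have "- (p \<bullet> (x - y)) \<le> rbifun F1 g1 x y" if "x \<in> edom g1" for x
    using rbifun_subgradient[OF g(1) *(3) \<open>y \<in> edom g1\<close> that, of F1] *(4) by simp
  ultimately show ?thesis using that[of p] * S2_edom D by auto
qed

text \<open>
  A solution of the hierarchical problem has subgradients of both functions, which replaces the
  separation argument that a general convex function would need.
\<close>
lemma affine_minorants:
  obtains q1 c1 q2 c2 where "\<And>x. ereal (q1 \<bullet> x + c1) \<le> g1 x" "\<And>x. ereal (q2 \<bullet> x + c2) \<le> g2 x"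
proof -
  obtain y where "y \<in> S1" using S1(2) by blast
  then obtain p q where *: "y \<in> S2" "p \<in> normal_cone S2 y" "q \<in> subdiff g1 y" "F1 y + q = - p"
    by (rule S1_decomposition)
  show ?thesis
    using that subdiff_affine_minorant[OF g(1) *(3)]
      subdiff_affine_minorant[OF g(2) S2_subgradient[OF *(1)]] by blast
qed

lemma D_nonempty: "D \<noteq> {}"
  using S1(2) S1_normal_vector by blast

section \<open>Energy descent along the iterates\<close>
definition objective :: "nat \<Rightarrow> 'a \<Rightarrow> ereal" where
  "objective k x = ereal (t k) * (g2 x + ereal (\<sigma> k) * g1 x)"

lemma rval_objective:
  assumes "x \<in> D"
  shows "rval (objective k) x = t k * (rval g2 x + \<sigma> k * rval g1 x)"
proof -
  have "g1 x = ereal (rval g1 x)" "g2 x = ereal (rval g2 x)"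
    using assms g unfolding D by (auto intro: Gamma0_finite)
  then show ?thesis
    unfolding objective_def by (metis plus_ereal.simps(1) real_of_ereal.simps(1) times_ereal.simps(1))
qed

lemma objective_prox:
  assumes k: "k \<ge> 1"
  shows "prox (objective k) u \<in> D"
    and "x \<in> D \<Longrightarrow> rval (objective k) (prox (objective k) u) - rval (objective k) x
        \<le> (u - prox (objective k) u) \<bullet> (prox (objective k) u - x)"
proof -
  have p: "t k > 0" "\<sigma> k > 0" using pos k by auto
  have scaled: "(\<lambda>x. ereal (\<sigma> k) * g1 x) \<in> Gamma0" using g p by (intro Gamma0_scale)
  have edom_scaled: "edom (\<lambda>x. ereal (\<sigma> k) * g1 x) = edom g1"
    using p by (auto simp: edom_def)
  have sum: "(\<lambda>x. g2 x + ereal (\<sigma> k) * g1 x) \<in> Gamma0"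
    using Gamma0_add[OF g(2) scaled] edom_scaled D_nonempty D by auto
  have obj: "objective k \<in> Gamma0"
    unfolding objective_def[abs_def] using Gamma0_scale[OF sum p(1)] .
  have dom: "edom (objective k) = D"
    using p edom_add_scaled[OF g(2,1) p(2)] unfolding objective_def[abs_def] D
    by (auto simp: edom_def)
  obtain q1 c1 q2 c2 where m: "\<And>x. ereal (q1 \<bullet> x + c1) \<le> g1 x" "\<And>x. ereal (q2 \<bullet> x + c2) \<le> g2 x"
    by (rule affine_minorants) blast
  have "ereal ((t k *\<^sub>R (q2 + \<sigma> k *\<^sub>R q1)) \<bullet> x + t k * (c2 + \<sigma> k * c1)) \<le> objective k x" for x
  proof -
    have "ereal (t k) * (ereal (q2 \<bullet> x + c2) + ereal (\<sigma> k) * ereal (q1 \<bullet> x + c1)) \<le> objective k x"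
      unfolding objective_def using p m by (intro ereal_mult_left_mono add_mono) auto
    then show ?thesis by (simp add: inner_add algebra_simps)
  qed
  note P = prox_variational[OF obj this, unfolded dom]
  show "prox (objective k) u \<in> D" by (rule P)
  show "rval (objective k) (prox (objective k) u) - rval (objective k) x
        \<le> (u - prox (objective k) u) \<bullet> (prox (objective k) u - x)" if "x \<in> D"
    using P(2) that by blast
qed

definition V :: "nat \<Rightarrow> 'a \<Rightarrow> 'a" where
  "V k x = F2 x + \<sigma> k *\<^sub>R F1 x"

lemma iterates:
  shows "w 0 = z 1"
    and "k \<ge> 1 \<Longrightarrow> w k = prox (objective k) (z k - t k *\<^sub>R V k (w (k - 1)))"
    and "k \<ge> 1 \<Longrightarrow> z (k + 1) = prox (objective k) (z k - t k *\<^sub>R V k (w k))"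
  using iter unfolding optimistic_eg_def Let_def objective_def[abs_def] V_def by auto

lemma iterates_in_D:
  assumes "k \<ge> 1"
  shows "w k \<in> D" "z (k + 1) \<in> D"
  using assms iterates(2,3)[OF assms] objective_prox(1) by metis+

lemma V_lipschitz:
  assumes "k \<ge> 1"
  shows "norm (V k x - V k y) \<le> (L2 + \<sigma> k * L1) * norm (x - y)"
proof -
  have "norm (V k x - V k y) = norm ((F2 x - F2 y) + \<sigma> k *\<^sub>R (F1 x - F1 y))"
    unfolding V_def by (simp add: algebra_simps)
  also have "\<dots> \<le> norm (F2 x - F2 y) + \<sigma> k * norm (F1 x - F1 y)"
    using norm_triangle_ineq[of "F2 x - F2 y" "\<sigma> k *\<^sub>R (F1 x - F1 y)"]
      pos(2)[rule_format, OF assms] by simp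
  also have "\<dots> \<le> L2 * norm (x - y) + \<sigma> k * (L1 * norm (x - y))"
    using lipschitz_onD[OF F1(2), of x y] lipschitz_onD[OF F2(2), of x y] pos(2) assms
    by (intro add_mono mult_left_mono) (auto simp: dist_norm)
  finally show ?thesis by (simp add: algebra_simps)
qed

text \<open>
  The second summand remembers how far \<open>z k\<close> is from the half step at which the operator was last
  evaluated. At \<open>k = 1\<close> it vanishes, as \<open>w 0 = z 1\<close>.
\<close>
definition energy :: "'a \<Rightarrow> nat \<Rightarrow> real" where
  "energy x k = (norm (z k - x))\<^sup>2 / 2 + (norm (z k - w (k - 1)))\<^sup>2 / 8"

lemma energy_nonneg: "0 \<le> energy x k"
  by (simp add: energy_def)

lemma energy_1: "energy x 1 = (norm (z 1 - x))\<^sup>2 / 2"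
  by (simp add: energy_def iterates(1))

text \<open>
  The step estimate contains \<open>V\<^sub>k\<close> at \<open>w k\<close>, hence both bifunctions with base point \<open>w k\<close>. Monotonicity
  is used for \<open>F1\<close> only: the term \<open>rbifun F2 g2 x (w k)\<close> is the one that occurs in the function
  \<^const>\<open>phi\<close>.
\<close>
lemma energy_descent_mixed:
  assumes k: "k \<ge> 1" and x: "x \<in> D"
  shows "t k * (\<sigma> k * rbifun F1 g1 (w k) x - rbifun F2 g2 x (w k)) \<le> energy x k - energy x (k + 1)"
proof -
  let ?G = "\<lambda>x. rval g2 x + \<sigma> k * rval g1 x"
  have p: "t k > 0" "\<sigma> k > 0" using pos k by auto
  have half: "t k * (?G (w k) - ?G (z (k + 1)))
      \<le> (z k - t k *\<^sub>R V k (w (k - 1)) - w k) \<bullet> (w k - z (k + 1))"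
    using objective_prox(2)[OF k iterates_in_D(2)[OF k], of "z k - t k *\<^sub>R V k (w (k - 1))"]
    unfolding iterates(2)[OF k, symmetric]
    by (simp add: rval_objective iterates_in_D[OF k] iterates_in_D(2)[OF k, simplified] algebra_simps)
  have full: "t k * (?G (z (k + 1)) - ?G x)
      \<le> (z k - t k *\<^sub>R V k (w k) - z (k + 1)) \<bullet> (z (k + 1) - x)"
    using objective_prox(2)[OF k x, of "z k - t k *\<^sub>R V k (w k)"]
    unfolding iterates(3)[OF k, symmetric]
    by (simp add: rval_objective x iterates_in_D[OF k] iterates_in_D(2)[OF k, simplified] algebra_simps)
  have L: "0 \<le> L2 + \<sigma> k * L1"
    using lipschitz_on_nonneg[OF F1(2)] lipschitz_on_nonneg[OF F2(2)] p by simp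
  have "t k * (V k (w k) \<bullet> (w k - x) + ?G (w k) - ?G x) \<le> energy x k - energy x (k + 1)"
    using optimistic_step_descent[OF half full V_lipschitz[OF k] L] p step k
    unfolding energy_def by simp
  moreover have "V k (w k) \<bullet> (w k - x) + ?G (w k) - ?G x
      = - rbifun F2 g2 x (w k) - \<sigma> k * rbifun F1 g1 x (w k)"
    unfolding rbifun_def V_def by (simp add: inner_add inner_diff algebra_simps)
  moreover have "\<sigma> k * rbifun F1 g1 (w k) x \<le> - (\<sigma> k * rbifun F1 g1 x (w k))"
    using mult_left_mono[OF rbifun_monotone[OF F1(1), of g1 "w k" x], of "\<sigma> k"] p by simp
  then have "t k * (\<sigma> k * rbifun F1 g1 (w k) x - rbifun F2 g2 x (w k))
      \<le> t k * (- rbifun F2 g2 x (w k) - \<sigma> k * rbifun F1 g1 x (w k))"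
    using p by (intro mult_left_mono) auto
  ultimately show ?thesis by simp
qed

lemma energy_descent:
  assumes k: "k \<ge> 1" and x: "x \<in> D"
  shows "t k * (\<sigma> k * rbifun F1 g1 (w k) x + rbifun F2 g2 (w k) x) \<le> energy x k - energy x (k + 1)"
proof -
  have "t k * (\<sigma> k * rbifun F1 g1 (w k) x + rbifun F2 g2 (w k) x)
      \<le> t k * (\<sigma> k * rbifun F1 g1 (w k) x - rbifun F2 g2 x (w k))"
    using rbifun_monotone[OF F2(1), of g2 "w k" x] pos k by (intro mult_left_mono) (auto intro: less_imp_le)
  then show ?thesis using energy_descent_mixed[OF assms] by linarith
qed


section \<open>Boundedness of the iterates\<close>
text \<open>
  As \<open>p\<close> is normal to \<open>S2\<close> at \<open>y\<close>, the support function is attained at \<open>y\<close>; the supremum over \<open>S2\<close>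
  is at least its value at \<open>y\<close>, and the one in \<^const>\<open>phi\<close> at least its value at \<open>x\<close>. Taking \<open>x = y\<close>
  shows that the excess is nonnegative.
\<close>
lemma phi_support_excess:
  assumes y: "y \<in> S2" "p \<in> normal_cone S2 y" and s: "s > 0" and x: "x \<in> edom g2"
  shows "ereal (rbifun F2 g2 y x + s * (p \<bullet> (x - y)))
    \<le> (SUP v\<in>S2. phi F2 g2 v (s *\<^sub>R p)) - support_fn (s *\<^sub>R p) S2"
proof -
  have supp: "support_fn (s *\<^sub>R p) S2 = ereal (s * (p \<bullet> y))"
    unfolding support_fn_def
  proof (rule antisym)
    show "(SUP v\<in>S2. ereal ((s *\<^sub>R p) \<bullet> v)) \<le> ereal (s * (p \<bullet> y))"
      using y s by (auto intro!: SUP_least simp: normal_cone_def inner_diff)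
    show "ereal (s * (p \<bullet> y)) \<le> (SUP v\<in>S2. ereal ((s *\<^sub>R p) \<bullet> v))"
      using y(1) by (intro SUP_upper2[OF y(1)]) auto
  qed
  have "ereal (rbifun F2 g2 y x + s * (p \<bullet> x)) = bifun F2 g2 y x + ereal (x \<bullet> (s *\<^sub>R p))"
    using bifun_eq_rbifun[OF g(2) S2_edom[OF y(1)] x] by (simp add: inner_commute)
  also have "\<dots> \<le> phi F2 g2 y (s *\<^sub>R p)"
    unfolding phi_def using x by (rule SUP_upper)
  also have "\<dots> \<le> (SUP v\<in>S2. phi F2 g2 v (s *\<^sub>R p))"
    using y(1) by (rule SUP_upper)
  finally have "ereal (rbifun F2 g2 y x + s * (p \<bullet> x)) - ereal (s * (p \<bullet> y))
      \<le> (SUP v\<in>S2. phi F2 g2 v (s *\<^sub>R p)) - support_fn (s *\<^sub>R p) S2"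
    unfolding supp by (intro ereal_minus_mono) auto
  then show ?thesis by (simp add: inner_diff algebra_simps)
qed

text \<open>
  At a solution \<open>y\<close> with normal vector \<open>p\<close>, the energy grows in each step by at most the
  corresponding term of the series for \<open>p\<close>.
\<close>
lemma energy_bounded_of_summable_excess:
  assumes y: "y \<in> S1"
    and sum: "\<forall>p\<in>range_normal_cone S2.
      (\<Sum>n. ereal (t (Suc n)) *
        ((SUP x\<in>S2. phi F2 g2 x (\<sigma> (Suc n) *\<^sub>R p)) - support_fn (\<sigma> (Suc n) *\<^sub>R p) S2)) < \<infinity>"
  shows "\<exists>M. \<forall>k\<ge>1. energy y k \<le> M"
proof -
  obtain p where p: "y \<in> S2" "y \<in> D" "p \<in> normal_cone S2 y"
    "\<And>x. x \<in> edom g1 \<Longrightarrow> - (p \<bullet> (x - y)) \<le> rbifun F1 g1 x y"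
    using S1_normal_vector[OF y] by blast
  define e where "e = (\<lambda>n. ereal (t (Suc n)) *
    ((SUP x\<in>S2. phi F2 g2 x (\<sigma> (Suc n) *\<^sub>R p)) - support_fn (\<sigma> (Suc n) *\<^sub>R p) S2))"
  have e_ge: "ereal (t (Suc n) * (rbifun F2 g2 y x + \<sigma> (Suc n) * (p \<bullet> (x - y)))) \<le> e n"
    if "x \<in> edom g2" for n x
  proof -
    have "ereal (t (Suc n)) * ereal (rbifun F2 g2 y x + \<sigma> (Suc n) * (p \<bullet> (x - y))) \<le> e n"
      unfolding e_def using pos p that
      by (intro ereal_mult_left_mono phi_support_excess) (auto intro: less_imp_le)
    then show ?thesis by simp
  qed
  have e_nonneg: "0 \<le> e n" for n
    using e_ge[OF S2_edom[OF p(1)], of n] by (simp add: rbifun_def zero_ereal_def)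
  \<comment> \<open>the normal vector bounds the upper-level bifunction from below by a linear term in \<open>p\<close>\<close>
  have incr: "ereal (energy y (Suc (Suc n)) - energy y (Suc n)) \<le> e n" for n
  proof -
    let ?k = "Suc n"
    have k: "?k \<ge> 1" by simp
    have w: "w ?k \<in> edom g1" "w ?k \<in> edom g2" using iterates_in_D(1)[OF k] D by auto
    have "\<sigma> ?k * - (p \<bullet> (w ?k - y)) \<le> \<sigma> ?k * rbifun F1 g1 (w ?k) y"
      using pos p(4)[OF w(1)] by (intro mult_left_mono) (auto intro: less_imp_le)
    then have "t ?k * - (rbifun F2 g2 y (w ?k) + \<sigma> ?k * (p \<bullet> (w ?k - y)))
        \<le> t ?k * (\<sigma> ?k * rbifun F1 g1 (w ?k) y - rbifun F2 g2 y (w ?k))"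
      using pos by (intro mult_left_mono) (auto intro: less_imp_le)
    also have "\<dots> \<le> energy y ?k - energy y (?k + 1)"
      by (rule energy_descent_mixed[OF k p(2)])
    finally have "energy y (Suc ?k) - energy y ?k
        \<le> t ?k * (rbifun F2 g2 y (w ?k) + \<sigma> ?k * (p \<bullet> (w ?k - y)))" by (simp add: algebra_simps)
    then show ?thesis using e_ge[OF w(2), of n] by (meson ereal_less_eq(3) order_trans)
  qed
  have fin: "suminf e < \<infinity>"
    using sum p unfolding e_def range_normal_cone_def by auto
  have "0 \<le> suminf e" using suminf_upper[of e 0] e_nonneg by simp
  with fin obtain M where M: "suminf e = ereal M" by (cases "suminf e") auto
  have "energy y (Suc N) \<le> energy y 1 + M" for N
  proof -
    have "ereal (\<Sum>n<N. energy y (Suc (Suc n)) - energy y (Suc n)) \<le> (\<Sum>n<N. e n)"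
      unfolding sum_ereal[symmetric] by (intro sum_mono incr)
    also have "\<dots> \<le> ereal M" using suminf_upper[of e N] e_nonneg M by simp
    finally show ?thesis
      using sum_lessThan_telescope[of "\<lambda>n. energy y (Suc n)" N] by simp
  qed
  then have "energy y k \<le> energy y 1 + M" if "k \<ge> 1" for k
    using that by (cases k) auto
  then show ?thesis by blast
qed

lemma iterates_bounded:
  obtains R where "\<And>k. k \<ge> 1 \<Longrightarrow> norm (z k) \<le> R" "\<And>k. norm (w k) \<le> R"
proof -
  have "\<exists>R. \<forall>k\<ge>1. norm (z (k + 1)) \<le> R \<and> norm (w k) \<le> R"
    using alt
  proof
    assume "compact D"
    then obtain R where "\<forall>x\<in>D. norm x \<le> R"
      using compact_imp_bounded bounded_iff by metis
    then show ?thesis using iterates_in_D by blast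
  next
    assume *: "\<forall>p\<in>range_normal_cone S2.
      (\<Sum>n. ereal (t (Suc n)) *
        ((SUP x\<in>S2. phi F2 g2 x (\<sigma> (Suc n) *\<^sub>R p)) - support_fn (\<sigma> (Suc n) *\<^sub>R p) S2)) < \<infinity>"
    obtain y where y: "y \<in> S1" using S1(2) by blast
    obtain M where M: "\<And>k. k \<ge> 1 \<Longrightarrow> energy y k \<le> M"
      using energy_bounded_of_summable_excess[OF y *] by blast
    have M0: "M \<ge> 0" using M[of 1] energy_nonneg[of y 1] by simp
    have "norm (z (k + 1)) \<le> norm y + sqrt (8 * M) + sqrt (8 * M)
        \<and> norm (w k) \<le> norm y + sqrt (8 * M) + sqrt (8 * M)" if k: "k \<ge> 1" for k
    proof -
      have en: "energy y (k + 1) \<le> M" using k by (intro M) simp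
      have "(norm (z (k + 1) - y))\<^sup>2 \<le> 8 * M" "(norm (z (k + 1) - w k))\<^sup>2 \<le> 8 * M"
        using en M0 zero_le_power2[of "norm (z (k + 1) - y)"] zero_le_power2[of "norm (z (k + 1) - w k)"]
        unfolding energy_def diff_add_inverse2 by linarith+
      then have "norm (z (k + 1) - y) \<le> sqrt (8 * M)" "norm (z (k + 1) - w k) \<le> sqrt (8 * M)"
        by (auto intro: real_le_rsqrt)
      moreover have "norm (z (k + 1)) \<le> norm y + norm (z (k + 1) - y)"
        by (rule norm_triangle_sub)
      moreover have "norm (w k) \<le> norm (z (k + 1)) + norm (z (k + 1) - w k)"
        using norm_triangle_sub[of "w k" "z (k + 1)"] by (simp add: norm_minus_commute)
      moreover have "0 \<le> sqrt (8 * M)" using M0 by simp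
      ultimately show ?thesis by linarith
    qed
    then show ?thesis by blast
  qed
  then obtain R where R: "\<And>k. k \<ge> 1 \<Longrightarrow> norm (z (k + 1)) \<le> R" "\<And>k. k \<ge> 1 \<Longrightarrow> norm (w k) \<le> R"
    by blast
  have "norm (z k) \<le> max R (norm (z 1))" if "k \<ge> 1" for k
    using R(1)[of "k - 1"] that by (cases "k = 1") (auto simp: le_max_iff_disj)
  moreover have "norm (w k) \<le> max R (norm (z 1))" for k
    using R(2)[of k] iterates(1) by (cases "k = 0") (auto simp: le_max_iff_disj)
  ultimately show ?thesis using that by blast
qed

text \<open>
  Boundedness of the iterates makes the energy bounded for all comparison points, although the
  summability argument bounds it at solutions only.
\<close>
lemma energy_bounded_uniformly:
  assumes "bounded U"
  obtains M where "M > 0" "\<And>x k. x \<in> U \<Longrightarrow> k \<ge> 1 \<Longrightarrow> energy x k \<le> M"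
proof -
  obtain R where R: "\<And>k. k \<ge> 1 \<Longrightarrow> norm (z k) \<le> R" "\<And>k. norm (w k) \<le> R"
    using iterates_bounded by blast
  obtain b where b: "\<And>x. x \<in> U \<Longrightarrow> norm x \<le> b"
    using assms by (auto simp: bounded_iff)
  have "energy x k \<le> (R + b)\<^sup>2 / 2 + (R + R)\<^sup>2 / 8 + 1" if "x \<in> U" "k \<ge> 1" for x k
  proof -
    have "norm (z k - x) \<le> R + b"
      using norm_triangle_ineq4[of "z k" x] R(1)[OF that(2)] b[OF that(1)] by linarith
    moreover have "norm (z k - w (k - 1)) \<le> R + R"
      using norm_triangle_ineq4[of "z k" "w (k - 1)"] R(1)[OF that(2)] R(2)[of "k - 1"] by linarith
    ultimately have "(norm (z k - x))\<^sup>2 \<le> (R + b)\<^sup>2" "(norm (z k - w (k - 1)))\<^sup>2 \<le> (R + R)\<^sup>2"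
      by (meson norm_ge_zero power_mono)+
    then show ?thesis unfolding energy_def by linarith
  qed
  moreover have "(R + b)\<^sup>2 / 2 + (R + R)\<^sup>2 / 8 + 1 > 0"
    by (intro add_nonneg_pos) auto
  ultimately show ?thesis using that by blast
qed

text \<open>
  Lower semicontinuity gives no upper bound on a compact set. The bound comes from the oscillation
  hypothesis for \<open>U\<close> and a single point of \<open>D\<close>.
\<close>
lemma g1_bounded_above:
  assumes U: "compact U" "U \<subseteq> D"
  obtains c where "\<And>x. x \<in> U \<Longrightarrow> rval g1 x \<le> c"
proof -
  obtain y where y: "y \<in> D" using D_nonempty by blast
  let ?s = "SUP (x, y)\<in>U \<times> {y}. \<bar>g1 x - g1 y\<bar>"
  have "?s < \<infinity>" using osc U y by simp
  have fin: "g1 x = ereal (rval g1 x)" if "x \<in> D" for x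
    using that D g by (intro Gamma0_finite) auto
  have bd: "ereal \<bar>rval g1 x - rval g1 y\<bar> \<le> ?s" if "x \<in> U" for x
  proof -
    have "ereal \<bar>rval g1 x - rval g1 y\<bar> = \<bar>g1 x - g1 y\<bar>"
      using fin[of x] fin[OF y] that U by (metis abs_ereal.simps(1) ereal_minus(1) subsetD)
    also have "\<dots> \<le> ?s" using that by (intro SUP_upper2[of "(x, y)"]) auto
    finally show ?thesis .
  qed
  have "rval g1 x \<le> rval g1 y + real_of_ereal ?s" if "x \<in> U" for x
    using bd[OF that] \<open>?s < \<infinity>\<close> by (cases ?s) auto
  then show ?thesis using that by blast
qed

lemma optimality_bifun_bounded_below:
  assumes U: "compact U" "U \<subseteq> D"
  obtains C where "C > 0" "\<And>x k. x \<in> U \<Longrightarrow> k \<ge> 1 \<Longrightarrow> - C \<le> rbifun F1 g1 (w k) x"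
proof -
  obtain R where R: "\<And>k. norm (w k) \<le> R"
    using iterates_bounded by blast
  obtain c where c: "\<And>x. x \<in> U \<Longrightarrow> rval g1 x \<le> c"
    using g1_bounded_above[OF U] by blast
  obtain b where b: "\<And>x. x \<in> U \<Longrightarrow> norm x \<le> b"
    using compact_imp_bounded[OF U(1)] by (auto simp: bounded_iff)
  have "compact (F1 ` U)"
    using U(1) lipschitz_on_continuous_on[OF F1(2)] continuous_on_subset
    by (intro compact_continuous_image) blast+
  then obtain f where f: "\<And>x. x \<in> U \<Longrightarrow> norm (F1 x) \<le> f"
    using compact_imp_bounded[of "F1 ` U"] by (auto simp: bounded_iff)
  obtain q1 c1 q2 c2 where m: "\<And>x. ereal (q1 \<bullet> x + c1) \<le> g1 x" "\<And>x. ereal (q2 \<bullet> x + c2) \<le> g2 x"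
    by (rule affine_minorants) blast
  \<comment> \<open>Cauchy-Schwarz for the pairing with \<open>F1\<close>, the affine minorant for \<open>g1\<close> at the iterate, and the
    upper bound \<open>c\<close> for \<open>g1\<close> on \<open>U\<close>\<close>
  define C where "C = f * (R + b) + norm q1 * R - c1 + c"
  have "- C \<le> rbifun F1 g1 (w k) x" if x: "x \<in> U" and k: "k \<ge> 1" for x k
  proof -
    have "w k \<in> edom g1" using iterates_in_D(1)[OF k] D by simp
    then have "q1 \<bullet> w k + c1 \<le> rval g1 (w k)"
      using m(1)[of "w k"] Gamma0_finite[OF g(1)] by (metis ereal_less_eq(3))
    moreover have "- (norm q1 * R) \<le> q1 \<bullet> w k"
    proof -
      have "\<bar>q1 \<bullet> w k\<bar> \<le> norm q1 * norm (w k)" by (rule Cauchy_Schwarz_ineq2)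
      also have "\<dots> \<le> norm q1 * R" using R by (intro mult_left_mono) auto
      finally show ?thesis by linarith
    qed
    moreover have "- (f * (R + b)) \<le> F1 x \<bullet> (w k - x)"
    proof -
      have "\<bar>F1 x \<bullet> (w k - x)\<bar> \<le> norm (F1 x) * norm (w k - x)" by (rule Cauchy_Schwarz_ineq2)
      also have "\<dots> \<le> f * (R + b)"
        using f[OF x] norm_triangle_ineq4[of "w k" x] R[of k] b[OF x]
        by (intro mult_mono) (auto intro: order_trans[OF norm_ge_zero])
      finally show ?thesis by linarith
    qed
    ultimately show ?thesis
      using c[OF x] unfolding rbifun_def C_def by linarith
  qed
  then have "- max 1 C \<le> rbifun F1 g1 (w k) x" if "x \<in> U" "k \<ge> 1" for x k
    using that by fastforce
  then show ?thesis using that[of "max 1 C"] by simp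
qed

section \<open>Bounds on the gap functions at the averaged iterate\<close>
lemma T_pos: "K \<ge> 1 \<Longrightarrow> T K > 0"
  unfolding T using pos by (intro sum_pos) auto

lemma zbar_in_D:
  assumes "K \<ge> 1"
  shows "zbar K \<in> D"
proof -
  have "zbar K = (\<Sum>k=1..K. (t k / T K) *\<^sub>R w k)"
    unfolding zbar by (simp add: scaleR_sum_right)
  moreover have "(\<Sum>k=1..K. t k / T K) = 1"
    using T_pos[OF assms] by (simp add: sum_divide_distrib[symmetric] T)
  then have "(\<Sum>k=1..K. (t k / T K) *\<^sub>R w k) \<in> D"
    using T_pos[OF assms] pos iterates_in_D(1)
    by (intro convex_sum convex_D) (auto intro!: divide_nonneg_nonneg less_imp_le)
  ultimately show ?thesis by simp
qed

lemma rbifun_zbar_le: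
  assumes "K \<ge> 1" "g \<in> {g1, g2}"
  shows "T K * rbifun F g (zbar K) y \<le> (\<Sum>k=1..K. t k * rbifun F g (w k) y)"
  using rbifun_average_le[of g "{1..K}" w t F y] assms g pos iterates_in_D(1) D
  unfolding zbar T by auto

text \<open>
  Summing the energy descent, the upper-level terms \<open>t k * \<sigma> k * H\<^sub>1(w k, x)\<close> are bounded below by
  \<open>- C * t k * \<sigma> k\<close>, which is where the perturbation term of the bound comes from.
\<close>
lemma feasibility_gap_bound:
  assumes U: "U \<subseteq> D" "U \<noteq> {}" "compact U"
  shows "\<exists>C>0. \<forall>K\<ge>1. gap F2 g2 (zbar K) U
    \<le> ereal ((SUP x\<in>U. (norm (z 1 - x))\<^sup>2) / (2 * T K) + TS K / T K * C)"
proof -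
  obtain C where C: "C > 0" "\<And>x k. x \<in> U \<Longrightarrow> k \<ge> 1 \<Longrightarrow> - C \<le> rbifun F1 g1 (w k) x"
    using optimality_bifun_bounded_below[OF U(3,1)] by blast
  have bdd: "bdd_above ((\<lambda>x. (norm (z 1 - x))\<^sup>2) ` U)"
    using U(3) by (intro bounded_imp_bdd_above compact_imp_bounded compact_continuous_image)
      (auto intro!: continuous_intros)
  have "bifun F2 g2 (zbar K) x
      \<le> ereal ((SUP x\<in>U. (norm (z 1 - x))\<^sup>2) / (2 * T K) + TS K / T K * C)"
    if K: "K \<ge> 1" and x: "x \<in> U" for K x
  proof -
    have xD: "x \<in> D" using x U by blast
    have "T K * rbifun F2 g2 (zbar K) x \<le> (\<Sum>k=1..K. t k * rbifun F2 g2 (w k) x)"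
      using rbifun_zbar_le[OF K] by blast
    also have "\<dots> \<le> (\<Sum>k=1..K. (energy x k - energy x (Suc k)) + t k * \<sigma> k * C)"
    proof (rule sum_mono)
      fix k assume "k \<in> {1..K}"
      then have k: "k \<ge> 1" by simp
      have "t k * \<sigma> k * - C \<le> t k * \<sigma> k * rbifun F1 g1 (w k) x"
        using C(2)[OF x k] pos k by (intro mult_left_mono) (auto intro: less_imp_le)
      then show "t k * rbifun F2 g2 (w k) x \<le> (energy x k - energy x (Suc k)) + t k * \<sigma> k * C"
        using energy_descent[OF k xD] by (simp add: algebra_simps)
    qed
    also have "\<dots> = energy x 1 - energy x (Suc K) + TS K * C"
      using sum_Suc_diff[of 1 K "\<lambda>k. - energy x k"] K
      by (simp add: sum.distrib TS sum_distrib_right)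
    also have "\<dots> \<le> (SUP x\<in>U. (norm (z 1 - x))\<^sup>2) / 2 + TS K * C"
      using energy_nonneg[of x "Suc K"] cSUP_upper[OF x bdd] unfolding energy_1 by simp
    finally have "rbifun F2 g2 (zbar K) x \<le> ((SUP x\<in>U. (norm (z 1 - x))\<^sup>2) / 2 + TS K * C) / T K"
      using T_pos[OF K] by (simp add: pos_le_divide_eq mult.commute)
    also have "\<dots> = (SUP x\<in>U. (norm (z 1 - x))\<^sup>2) / (2 * T K) + TS K / T K * C"
      by (simp add: add_divide_distrib)
    finally show ?thesis
      using bifun_eq_rbifun[OF g(2), of "zbar K" x F2] zbar_in_D[OF K] xD D by simp
  qed
  then show ?thesis
    using C(1) unfolding gap_def by (meson SUP_least)
qed

text \<open>
  At points of \<open>S2\<close> the lower-level bifunction is nonnegative and can be dropped from the energy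
  descent. Division by \<open>\<sigma> k\<close> then isolates the upper-level bifunction.
\<close>
lemma optimality_gap_upper:
  assumes U: "U \<subseteq> D" "compact U"
  shows "\<exists>C>0. \<forall>K\<ge>1. gap F1 g1 (zbar K) (U \<inter> S2) \<le> ereal (C / (T K * \<sigma> K))"
proof -
  obtain M where M: "M > 0" "\<And>x k. x \<in> U \<Longrightarrow> k \<ge> 1 \<Longrightarrow> energy x k \<le> M"
    using energy_bounded_uniformly[OF compact_imp_bounded[OF U(2)]] by blast
  have "bifun F1 g1 (zbar K) x \<le> ereal (M / (T K * \<sigma> K))"
    if K: "K \<ge> 1" and x: "x \<in> U \<inter> S2" for K x
  proof -
    have xD: "x \<in> D" using x U by blast
    have "T K * rbifun F1 g1 (zbar K) x \<le> (\<Sum>k=1..K. t k * rbifun F1 g1 (w k) x)"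
      using rbifun_zbar_le[OF K] by blast
    also have "\<dots> \<le> (\<Sum>k=1..K. (energy x k - energy x (k + 1)) / \<sigma> k)"
    proof (rule sum_mono)
      fix k assume "k \<in> {1..K}"
      then have k: "k \<ge> 1" by simp
      have "0 \<le> rbifun F2 g2 (w k) x"
        using feasibility_bifun_nonneg x iterates_in_D(1)[OF k] D by blast
      then have "0 \<le> t k * rbifun F2 g2 (w k) x"
        using pos k by (intro mult_nonneg_nonneg) (auto intro: less_imp_le)
      then have "t k * rbifun F1 g1 (w k) x * \<sigma> k \<le> energy x k - energy x (k + 1)"
        using energy_descent[OF k xD] by (simp add: algebra_simps)
      then show "t k * rbifun F1 g1 (w k) x \<le> (energy x k - energy x (k + 1)) / \<sigma> k"
        using pos k by (simp add: pos_le_divide_eq)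
    qed
    also have "\<dots> \<le> (M - energy x (K + 1)) / \<sigma> K"
      using weighted_telescope_le[of \<sigma> "energy x" M K] pos decr M(2) x K by auto
    also have "\<dots> \<le> M / \<sigma> K"
      using energy_nonneg[of x "K + 1"] pos K by (intro divide_right_mono) (auto intro: less_imp_le)
    finally have "rbifun F1 g1 (zbar K) x \<le> M / \<sigma> K / T K"
      using T_pos[OF K] by (simp only: pos_le_divide_eq) (simp add: mult.commute)
    then have "rbifun F1 g1 (zbar K) x \<le> M / (T K * \<sigma> K)" by (simp add: mult.commute)
    then show ?thesis
      using bifun_eq_rbifun[OF g(1), of "zbar K" x F1] zbar_in_D[OF K] xD D by simp
  qed
  then show ?thesis
    using M(1) unfolding gap_def by (meson SUP_least)
qed

text \<open>
  Let \<open>p\<close> be the normal vector at a solution \<open>y\<close> in \<open>U\<close>, so that the gap at \<open>x\<close> is at least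
  \<open>- \<langle>p, x - y\<rangle>\<close>. For any \<open>v \<in> S2\<close>, normality gives \<open>\<langle>p, v - y\<rangle> \<le> 0\<close>, so \<open>\<langle>p, x - y\<rangle>\<close> is at most
  \<open>\<langle>p, x - v\<rangle>\<close>, and the infimum over \<open>v\<close> gives the distance. Working with all \<open>v\<close> avoids the
  projection onto \<open>S2\<close>.
\<close>
lemma optimality_gap_lower:
  assumes U: "U \<inter> S1 \<noteq> {}"
  shows "\<exists>B>0. \<forall>K\<ge>1. ereal (- B * infdist (zbar K) S2) \<le> gap F1 g1 (zbar K) (U \<inter> S2)"
proof -
  obtain y where y: "y \<in> U" "y \<in> S1" using U by blast
  obtain p where p: "y \<in> S2" "y \<in> D" "p \<in> normal_cone S2 y"
    "\<And>x. x \<in> edom g1 \<Longrightarrow> - (p \<bullet> (x - y)) \<le> rbifun F1 g1 x y"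
    using S1_normal_vector[OF y(2)] by blast
  \<comment> \<open>the summand \<open>1\<close> keeps the constant positive when \<open>p = 0\<close>\<close>
  define B where "B = norm p + 1"
  have B: "B > 0" unfolding B_def by (simp add: add_nonneg_pos)
  have "ereal (- B * infdist (zbar K) S2) \<le> gap F1 g1 (zbar K) (U \<inter> S2)" if K: "K \<ge> 1" for K
  proof -
    let ?x = "zbar K"
    have x: "?x \<in> edom g1" using zbar_in_D[OF K] D by simp
    have "- rbifun F1 g1 ?x y / B \<le> dist ?x v" if v: "v \<in> S2" for v
    proof -
      have "- rbifun F1 g1 ?x y \<le> p \<bullet> (?x - y)" using p(4)[OF x] by linarith
      also have "\<dots> = p \<bullet> (?x - v) + p \<bullet> (v - y)" by (simp add: inner_diff)
      also have "\<dots> \<le> p \<bullet> (?x - v)"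
        using p(1,3) v by (auto simp: normal_cone_def)
      also have "\<dots> \<le> norm p * norm (?x - v)" by (rule norm_cauchy_schwarz)
      also have "\<dots> \<le> B * dist ?x v"
        unfolding B_def dist_norm by (intro mult_right_mono) auto
      finally show ?thesis using B by (simp only: pos_divide_le_eq mult.commute)
    qed
    then have "- rbifun F1 g1 ?x y / B \<le> infdist ?x S2"
      using p(1) unfolding infdist_def by (auto intro!: cINF_greatest)
    then have "- B * infdist ?x S2 \<le> rbifun F1 g1 ?x y"
      using B by (simp only: pos_divide_le_eq) (simp add: mult.commute)
    then have "ereal (- B * infdist ?x S2) \<le> bifun F1 g1 ?x y"
      using bifun_eq_rbifun[OF g(1) x, of y F1] p(2) D by simp
    also have "\<dots> \<le> gap F1 g1 ?x (U \<inter> S2)"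
      unfolding gap_def using y p by (intro SUP_upper) auto
    finally show ?thesis .
  qed
  then show ?thesis using B by blast
qed

lemma infdist_le_of_weakly_sharp:
  assumes sharp: "weakly_sharp F2 g2 S2 \<alpha> \<rho>" and U: "U \<inter> S2 \<noteq> {}"
    and K: "K \<ge> 1" and gap: "gap F2 g2 (zbar K) U \<le> ereal c"
  shows "infdist (zbar K) S2 \<le> (c / (\<alpha> / \<rho>)) powr (1 / \<rho>)"
proof -
  obtain y where y: "y \<in> U" "y \<in> S2" using U by blast
  have ar: "\<alpha> > 0" "\<rho> \<ge> 1" using sharp by (auto simp: weakly_sharp_def)
  have "ereal (\<alpha> / \<rho> * infdist (zbar K) S2 powr \<rho>) \<le> bifun F2 g2 (zbar K) y"
    using sharp y zbar_in_D[OF K] D by (auto simp: weakly_sharp_def)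
  also have "\<dots> \<le> gap F2 g2 (zbar K) U"
    unfolding gap_def using y(1) by (rule SUP_upper)
  also note gap
  finally have "\<alpha> / \<rho> * infdist (zbar K) S2 powr \<rho> \<le> c" by simp
  then have "infdist (zbar K) S2 powr \<rho> \<le> c / (\<alpha> / \<rho>)"
    using ar by (simp add: field_simps)
  then have "(infdist (zbar K) S2 powr \<rho>) powr (1 / \<rho>) \<le> (c / (\<alpha> / \<rho>)) powr (1 / \<rho>)"
    using ar by (intro powr_mono2) auto
  then show ?thesis using ar infdist_nonneg[of "zbar K" S2] by (simp add: powr_powr)
qed

end

section \<open>Convergence rates of the optimistic extragradient method\<close>
theorem theorem3p1:
  fixes F1 F2 :: "'a::{real_inner, polish_space} \<Rightarrow> 'a"
    and g1 g2 :: "'a \<Rightarrow> ereal"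
    and L1 L2 :: real
    and S1 S2 D :: "'a set"
    and t \<sigma> T TS :: "nat \<Rightarrow> real"
    and z w zbar :: "nat \<Rightarrow> 'a"
  assumes F1: "monotone_operator F1" "L1-lipschitz_on UNIV F1"
    and F2: "monotone_operator F2" "L2-lipschitz_on UNIV F2"
    and g: "g1 \<in> Gamma0" "g2 \<in> Gamma0"
    and D: "D = edom g1 \<inter> edom g2" "D \<noteq> {}" "closed D"
    and S2: "S2 = zer (\<lambda>x. F2 x +o subdiff g2 x)" "S2 \<noteq> {}"
    and S1: "S1 = hier_solutions F1 g1 S2"
      "S1 = zer (\<lambda>x. F1 x +o (subdiff g1 x + normal_cone S2 x))" "S1 \<noteq> {}"
    and osc: "\<forall>A B. compact A \<longrightarrow> compact B \<longrightarrow> A \<subseteq> D \<longrightarrow> B \<subseteq> D \<longrightarrow>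
      (SUP (x, y)\<in>A \<times> B. \<bar>g1 x - g1 y\<bar>) < \<infinity>"
    and pos: "\<forall>k\<ge>1. t k > 0" "\<forall>k\<ge>1. \<sigma> k > 0"
    and decr: "\<forall>k\<ge>1. \<sigma> (k + 1) \<le> \<sigma> k"
    and T: "T = (\<lambda>K. \<Sum>k=1..K. t k)"
    and TS: "TS = (\<lambda>K. \<Sum>k=1..K. t k * \<sigma> k)"
    and lims: "\<sigma> \<longlonglongrightarrow> 0"
      "filterlim T at_top sequentially"
      "filterlim (\<lambda>K. \<sigma> K * T K) at_top sequentially"
      "(\<lambda>K. TS K / T K) \<longlonglongrightarrow> 0"
    and alt:
      "(\<forall>p\<in>range_normal_cone S2.
          (\<Sum>n. ereal (t (Suc n)) *
             ((SUP x\<in>S2. phi F2 g2 x (\<sigma> (Suc n) *\<^sub>R p)) - support_fn (\<sigma> (Suc n) *\<^sub>R p) S2)) < \<infinity>)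
       \<or> compact D"
    and iter: "optimistic_eg F1 g1 F2 g2 t \<sigma> z w"
    and step: "\<forall>k\<ge>1. 16 * (t k)\<^sup>2 * (L2 + \<sigma> k * L1)\<^sup>2 \<le> 1"
    and zbar: "zbar = (\<lambda>K. (1 / T K) *\<^sub>R (\<Sum>k=1..K. t k *\<^sub>R w k))"
  shows "\<exists>CFeas B COpt :: 'a set \<Rightarrow> real.
    (\<forall>U2. U2 \<subseteq> D \<and> U2 \<noteq> {} \<and> compact U2 \<longrightarrow>
       CFeas U2 > 0 \<and>
       (\<forall>K\<ge>1. gap F2 g2 (zbar K) U2
          \<le> ereal ((SUP x\<in>U2. (norm (z 1 - x))\<^sup>2) / (2 * T K) + TS K / T K * CFeas U2))) \<and>
    (\<forall>U1. U1 \<subseteq> D \<and> compact U1 \<and> U1 \<inter> S1 \<noteq> {} \<longrightarrow>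
       B U1 > 0 \<and> COpt U1 > 0 \<and>
       (\<forall>K\<ge>1. ereal (- B U1 * infdist (zbar K) S2) \<le> gap F1 g1 (zbar K) (U1 \<inter> S2) \<and>
               gap F1 g1 (zbar K) (U1 \<inter> S2) \<le> ereal (COpt U1 / (T K * \<sigma> K)))) \<and>
    (\<forall>\<alpha> \<rho> U1 U2. weakly_sharp F2 g2 S2 \<alpha> \<rho> \<and>
       U2 \<subseteq> D \<and> U2 \<noteq> {} \<and> compact U2 \<and> U2 \<inter> S2 \<noteq> {} \<and>
       U1 \<subseteq> D \<and> compact U1 \<and> U1 \<inter> S1 \<noteq> {} \<longrightarrow>
       (\<forall>K\<ge>1. ereal (- B U1 *
            ((SUP x\<in>U2. (norm (z 1 - x))\<^sup>2) / (2 * T K * (\<alpha> / \<rho>))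
              + CFeas U2 * TS K / ((\<alpha> / \<rho>) * T K)) powr (1 / \<rho>))
          \<le> gap F1 g1 (zbar K) (U1 \<inter> S2)))"
proof -
  interpret hierarchical_oeg F1 F2 g1 g2 L1 L2 S1 S2 D t \<sigma> T TS z w zbar
    using F1 F2 g D(1) S2(1) S1(2,3) osc pos decr T TS alt iter step zbar
    by (rule hierarchical_oeg.intro)
  obtain CFeas where CFeas: "\<And>U2. U2 \<subseteq> D \<Longrightarrow> U2 \<noteq> {} \<Longrightarrow> compact U2 \<Longrightarrow> CFeas U2 > 0 \<and>
      (\<forall>K\<ge>1. gap F2 g2 (zbar K) U2
        \<le> ereal ((SUP x\<in>U2. (norm (z 1 - x))\<^sup>2) / (2 * T K) + TS K / T K * CFeas U2))"
    using feasibility_gap_bound by metis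
  obtain COpt where COpt: "\<And>U1. U1 \<subseteq> D \<Longrightarrow> compact U1 \<Longrightarrow> COpt U1 > 0 \<and>
      (\<forall>K\<ge>1. gap F1 g1 (zbar K) (U1 \<inter> S2) \<le> ereal (COpt U1 / (T K * \<sigma> K)))"
    using optimality_gap_upper by metis
  obtain B where B: "\<And>U1. U1 \<inter> S1 \<noteq> {} \<Longrightarrow> B U1 > 0 \<and>
      (\<forall>K\<ge>1. ereal (- B U1 * infdist (zbar K) S2) \<le> gap F1 g1 (zbar K) (U1 \<inter> S2))"
    using optimality_gap_lower by metis
  have sharp: "ereal (- B U1 *
            ((SUP x\<in>U2. (norm (z 1 - x))\<^sup>2) / (2 * T K * (\<alpha> / \<rho>))
              + CFeas U2 * TS K / ((\<alpha> / \<rho>) * T K)) powr (1 / \<rho>))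
          \<le> gap F1 g1 (zbar K) (U1 \<inter> S2)"
    if "weakly_sharp F2 g2 S2 \<alpha> \<rho>" "U2 \<subseteq> D" "U2 \<noteq> {}" "compact U2" "U2 \<inter> S2 \<noteq> {}"
      "U1 \<inter> S1 \<noteq> {}" and K: "K \<ge> 1" for \<alpha> \<rho> U1 U2 K
  proof -
    define c where "c = (SUP x\<in>U2. (norm (z 1 - x))\<^sup>2) / (2 * T K) + TS K / T K * CFeas U2"
    have scale: "(s / (2 * a) + b / a * c) / r = s / (2 * a * r) + c * b / (r * a)"
      for s a b c r :: real
      unfolding add_divide_distrib divide_divide_eq_left times_divide_eq_left
        mult.commute[of r a] mult.commute[of b c] ..
    have "infdist (zbar K) S2 \<le> (c / (\<alpha> / \<rho>)) powr (1 / \<rho>)"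
      using infdist_le_of_weakly_sharp[OF that(1,5) K] CFeas[OF that(2-4)] K unfolding c_def by simp
    also have "c / (\<alpha> / \<rho>) = (SUP x\<in>U2. (norm (z 1 - x))\<^sup>2) / (2 * T K * (\<alpha> / \<rho>))
        + CFeas U2 * TS K / ((\<alpha> / \<rho>) * T K)"
      unfolding c_def by (rule scale)
    finally have "ereal (- B U1 *
            ((SUP x\<in>U2. (norm (z 1 - x))\<^sup>2) / (2 * T K * (\<alpha> / \<rho>))
              + CFeas U2 * TS K / ((\<alpha> / \<rho>) * T K)) powr (1 / \<rho>))
        \<le> ereal (- B U1 * infdist (zbar K) S2)"
      using B[OF that(6)] by simp
    also have "\<dots> \<le> gap F1 g1 (zbar K) (U1 \<inter> S2)"
      using B[OF that(6)] K by blast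
    finally show ?thesis .
  qed
  show ?thesis
  proof (rule exI[of _ CFeas], rule exI[of _ B], rule exI[of _ COpt], intro conjI)
    show "\<forall>U2. U2 \<subseteq> D \<and> U2 \<noteq> {} \<and> compact U2 \<longrightarrow>
       CFeas U2 > 0 \<and>
       (\<forall>K\<ge>1. gap F2 g2 (zbar K) U2
          \<le> ereal ((SUP x\<in>U2. (norm (z 1 - x))\<^sup>2) / (2 * T K) + TS K / T K * CFeas U2))"
      by (intro allI impI CFeas) auto
  next
    show "\<forall>U1. U1 \<subseteq> D \<and> compact U1 \<and> U1 \<inter> S1 \<noteq> {} \<longrightarrow>
       B U1 > 0 \<and> COpt U1 > 0 \<and>
       (\<forall>K\<ge>1. ereal (- B U1 * infdist (zbar K) S2) \<le> gap F1 g1 (zbar K) (U1 \<inter> S2) \<and>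
               gap F1 g1 (zbar K) (U1 \<inter> S2) \<le> ereal (COpt U1 / (T K * \<sigma> K)))"
    proof (intro allI impI, elim conjE)
      fix U1 assume U1: "U1 \<subseteq> D" "compact U1" "U1 \<inter> S1 \<noteq> {}"
      show "B U1 > 0 \<and> COpt U1 > 0 \<and>
         (\<forall>K\<ge>1. ereal (- B U1 * infdist (zbar K) S2) \<le> gap F1 g1 (zbar K) (U1 \<inter> S2) \<and>
                 gap F1 g1 (zbar K) (U1 \<inter> S2) \<le> ereal (COpt U1 / (T K * \<sigma> K)))"
        using B[OF U1(3)] COpt[OF U1(1,2)] by simp
    qed
  next
    show "\<forall>\<alpha> \<rho> U1 U2. weakly_sharp F2 g2 S2 \<alpha> \<rho> \<and>
       U2 \<subseteq> D \<and> U2 \<noteq> {} \<and> compact U2 \<and> U2 \<inter> S2 \<noteq> {} \<and>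
       U1 \<subseteq> D \<and> compact U1 \<and> U1 \<inter> S1 \<noteq> {} \<longrightarrow>
       (\<forall>K\<ge>1. ereal (- B U1 *
            ((SUP x\<in>U2. (norm (z 1 - x))\<^sup>2) / (2 * T K * (\<alpha> / \<rho>))
              + CFeas U2 * TS K / ((\<alpha> / \<rho>) * T K)) powr (1 / \<rho>))
          \<le> gap F1 g1 (zbar K) (U1 \<inter> S2))"
      by (intro allI impI, elim conjE) (rule sharp)
  qed
qed

end
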